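(* Let $1<p<\infty$ and let $(h^{(p)}_i)_{i=0}^\infty$ be the normalized Haar basis for $L_p[0,1]$. Then, for each integer $m\ge 0$, there exists a positive integer $N(p,m)$ such that, for the space $X=\operatorname{span}(h^{(p)}_i)_{i=0}^m\subset L_p[0,1]$ and the dictionary $\mathcal{D}=(h^{(p)}_i)_{i=0}^m$, the $X$-Greedy Algorithm and the Dual Greedy Algorithm both terminate in at most $N(p,m)$ iterations for every initial vector $x\in X$.
   Context: Haar functions on $[0,1]$: $h_0\equiv 1$, and for $n\ge 0$, $0\le k<2^n$, $i=2^n+k$, $h_i=1$ on $[k/2^n,(2k+1)/2^{n+1})$, $h_i=-1$ on $[(2k+1)/2^{n+1},(k+1)/2^n)$, and $h_i=0$ elsewhere. Normalized: $h_i^{(p)}=h_i/\|h_i\|_p$. The space $X$ carries the norm of $L_p[0,1]$ (real scalars). Greedy algorithms. Let $X$ be a smooth finite-dimensional real Banach space and $\mathcal{D}\subset X$ a finite set of norm-one vectors spanning $X$. For nonzero $y\in X$, $F_y\in X^*$ denotes its (unique) norming functional: $\|F_y\|=1$, $F_y(y)=\|y\|$. A greedy step applied to a nonzero $y\in X$ selects $\varphi(y)\in\mathcal{D}$ by a selection criterion and then selects $\lambda(y)\in\mathbb{R}$ minimizing $\|y-\lambda\varphi(y)\|$ over $\lambda\in\mathbb{R}$. - $X$-Greedy Algorithm (XGA): $\varphi(y)$ is any element of $\mathcal{D}$ with $\min_{\lambda\in\mathbb{R}}\|y-\lambda\varphi(y)\|=\min_{\lambda\in\mathbb{R},\,\varphi\in\mathcal{D}}\|y-\lambda\varphi\|$.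 - Dual Greedy Algorithm (DGA): $\varphi(y)$ is any element of $\mathcal{D}$ with $|F_y(\varphi(y))|=\max_{\varphi\in\mathcal{D}}|F_y(\varphi)|$. From an initial vector $x$ one sets $x_0=x$ and, as long as $x_{n-1}\ne 0$, $x_n=x_{n-1}-\lambda(x_{n-1})\varphi(x_{n-1})$. The algorithm terminates in at most $N$ iterations if $x_n=0$ for some $n\le N$, whatever admissible choices are made. *)

theory Defs
  imports
    "HOL-Analysis.Analysis"
    "HOL-Library.Function_Algebras"
    "HOL-Library.Discrete_Functions"
begin

text \<open>Pointwise scalar multiplication makes functions a real vector space, so that the library's
  \<^const>\<open>span\<close> applies to sets of functions.\<close>

instantiation "fun" :: (type, real_vector) real_vector
begin

definition scaleR_fun :: "real \<Rightarrow> ('a \<Rightarrow> 'b) \<Rightarrow> 'a \<Rightarrow> 'b"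
  where "scaleR_fun c f = (\<lambda>t. c *\<^sub>R f t)"

instance
  by standard (auto simp: scaleR_fun_def plus_fun_def fun_eq_iff scaleR_add_right scaleR_add_left)

end

section \<open>Greedy algorithms\<close>

text \<open>The normed space is a linear subspace \<open>X\<close> of a real vector space together with a norm \<open>nrm\<close> on
  it; this is needed because neither the exponent nor the dimension of the subspaces of
  \<open>L\<^sub>p[0,1]\<close> below can be a parameter of a type.\<close>

definition dual_elem :: "('a::real_vector \<Rightarrow> real) \<Rightarrow> 'a set \<Rightarrow> ('a \<Rightarrow> real) \<Rightarrow> bool"
  where "dual_elem nrm X F \<longleftrightarrow>
    (\<forall>u\<in>X. \<forall>v\<in>X. F (u + v) = F u + F v) \<and>
    (\<forall>c. \<forall>u\<in>X. F (c *\<^sub>R u) = c * F u) \<and>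
    (\<exists>C. \<forall>u\<in>X. \<bar>F u\<bar> \<le> C * nrm u)"

definition dual_norm :: "('a::real_vector \<Rightarrow> real) \<Rightarrow> 'a set \<Rightarrow> ('a \<Rightarrow> real) \<Rightarrow> real"
  where "dual_norm nrm X F = (SUP u\<in>{u \<in> X. nrm u \<le> 1}. \<bar>F u\<bar>)"

text \<open>If \<open>X\<close> is smooth and \<open>y \<noteq> 0\<close>, the values of \<open>F\<close> on \<open>X\<close> are uniquely determined by the
  following; the values outside \<open>X\<close> are irrelevant.\<close>

definition norming_functional ::
    "('a::real_vector \<Rightarrow> real) \<Rightarrow> 'a set \<Rightarrow> 'a \<Rightarrow> ('a \<Rightarrow> real) \<Rightarrow> bool"
  where "norming_functional nrm X y F \<longleftrightarrow>
    dual_elem nrm X F \<and> dual_norm nrm X F = 1 \<and> F y = nrm y"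

text \<open>The double minimum over \<open>\<lambda>\<close> and the dictionary is attained with first component \<open>\<phi>\<close>.\<close>

definition xga_select :: "('a::real_vector \<Rightarrow> real) \<Rightarrow> 'a set \<Rightarrow> 'a \<Rightarrow> 'a \<Rightarrow> bool"
  where "xga_select nrm D y \<phi> \<longleftrightarrow> \<phi> \<in> D \<and>
    (\<exists>l. \<forall>\<psi>\<in>D. \<forall>m. nrm (y - l *\<^sub>R \<phi>) \<le> nrm (y - m *\<^sub>R \<psi>))"

definition dga_select ::
    "('a::real_vector \<Rightarrow> real) \<Rightarrow> 'a set \<Rightarrow> 'a set \<Rightarrow> 'a \<Rightarrow> 'a \<Rightarrow> bool"
  where "dga_select nrm X D y \<phi> \<longleftrightarrow> \<phi> \<in> D \<and>
    (\<exists>F. norming_functional nrm X y F \<and> (\<forall>\<psi>\<in>D. \<bar>F \<psi>\<bar> \<le> \<bar>F \<phi>\<bar>))"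

definition greedy_step ::
    "('a::real_vector \<Rightarrow> real) \<Rightarrow> ('a \<Rightarrow> 'a \<Rightarrow> bool) \<Rightarrow> 'a \<Rightarrow> 'a \<Rightarrow> bool"
  where "greedy_step nrm select y z \<longleftrightarrow>
    (\<exists>\<phi> l. select y \<phi> \<and> (\<forall>m. nrm (y - l *\<^sub>R \<phi>) \<le> nrm (y - m *\<^sub>R \<phi>)) \<and> z = y - l *\<^sub>R \<phi>)"

text \<open>A run of the algorithm is encoded as an infinite sequence whose entries are unconstrained
  after the first zero entry.\<close>

definition greedy_run ::
    "('a::real_vector \<Rightarrow> real) \<Rightarrow> ('a \<Rightarrow> 'a \<Rightarrow> bool) \<Rightarrow> 'a \<Rightarrow> (nat \<Rightarrow> 'a) \<Rightarrow> bool"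
  where "greedy_run nrm select x0 x \<longleftrightarrow>
    x 0 = x0 \<and> (\<forall>n. (\<forall>i\<le>n. x i \<noteq> 0) \<longrightarrow> greedy_step nrm select (x n) (x (Suc n)))"

definition terminates_within ::
    "('a::real_vector \<Rightarrow> real) \<Rightarrow> ('a \<Rightarrow> 'a \<Rightarrow> bool) \<Rightarrow> nat \<Rightarrow> 'a \<Rightarrow> bool"
  where "terminates_within nrm select N x0 \<longleftrightarrow>
    (\<forall>x. greedy_run nrm select x0 x \<longrightarrow> (\<exists>n\<le>N. x n = 0))"

section \<open>The Haar system in \<open>L\<^sub>p[0,1]\<close>\<close>

definition lp_norm :: "real \<Rightarrow> (real \<Rightarrow> real) \<Rightarrow> real"
  where "lp_norm p f = (LINT t:{0..1}|lborel. \<bar>f t\<bar> powr p) powr (1 / p)"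

text \<open>Functions on \<open>[0,1]\<close> are extended by zero to the real line. For \<open>i \<ge> 1\<close>, the number
  \<open>n = floor_log i\<close> is the unique one with \<open>2 ^ n \<le> i < 2 ^ (n + 1)\<close>.\<close>

definition haar :: "nat \<Rightarrow> real \<Rightarrow> real"
  where "haar i t =
    (if i = 0 then indicator {0..1} t
     else let n = floor_log i; k = i - 2 ^ n in
       indicator {real k / 2 ^ n ..< (2 * real k + 1) / 2 ^ (n + 1)} t
       - indicator {(2 * real k + 1) / 2 ^ (n + 1) ..< (real k + 1) / 2 ^ n} t)"

definition haar_normalized :: "real \<Rightarrow> nat \<Rightarrow> real \<Rightarrow> real"
  where "haar_normalized p i = (1 / lp_norm p (haar i)) *\<^sub>R haar i"

definition haar_dict :: "real \<Rightarrow> nat \<Rightarrow> (real \<Rightarrow> real) set"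
  where "haar_dict p m = haar_normalized p ` {0..m}"

text \<open>A linear combination of Haar functions that vanishes almost everywhere on \<open>[0,1]\<close> is the zero
  function. Hence this space of functions is isometric to the span of the Haar functions in
  \<open>L\<^sub>p[0,1]\<close>, where functions are identified almost everywhere, and \<open>0\<close> means the same in both.\<close>

definition haar_space :: "real \<Rightarrow> nat \<Rightarrow> (real \<Rightarrow> real) set"
  where "haar_space p m = span (haar_dict p m)"

end

theory Submission
  imports Defs
begin

text \<open>Call \<open>y - \<lambda> e\<^sub>i\<close> with the minimizing \<open>\<lambda>\<close> the step of \<open>y\<close> in direction \<open>i\<close>. On the unit sphere
  of the finite-dimensional space, uniform smoothness gives one \<open>\<theta> < 1\<close> such that every step that
  either algorithm may choose multiplies the norm by at most \<open>\<theta>\<close>. It is then enough to bound the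
  length of every sequence of steps with this property, whatever the selection rule.

  Since \<open>\<lambda>\<close> is a generalized mean of the values of \<open>y\<close> on the support of \<open>e\<^sub>i\<close>, steps are Lipschitz.
  Since \<open>e\<^sub>0, \<dots>, e\<^sub>k\<^sub>-\<^sub>1\<close> are constant on the support of \<open>e\<^sub>k\<close>, the step in direction \<open>k\<close> just
  deletes the last coordinate of a vector of \<open>span {e\<^sub>0, \<dots>, e\<^sub>k}\<close>. Induct on \<open>k\<close>. As long as
  direction \<open>k\<close> is not chosen, the last coordinate \<open>a\<close> stays fixed while the norm decays
  geometrically, and \<open>|a|\<close> is bounded by a multiple of the norm; so direction \<open>k\<close> is chosen soon, unless \<open>|a|\<close> is very small compared to the norm. In
  the latter case, the same directions applied to the vector without its last coordinate give
  a nearby sequence that reduces the norm by \<open>(1 + \<theta>) / 2\<close> in each step, and by induction that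
  sequence is short, at which point the norm has become comparable to \<open>|a|\<close>.\<close>

section \<open>Signed powers\<close>

text \<open>\<open>spow q u = sgn u * \<bar>u\<bar> powr q\<close>, written without \<open>sgn\<close> to make continuity at \<open>0\<close> evident.\<close>

definition spow :: "real \<Rightarrow> real \<Rightarrow> real"
  where "spow q u = max u 0 powr q - max (- u) 0 powr q"

lemma spow_nonneg: "0 \<le> u \<Longrightarrow> spow q u = u powr q"
  by (simp add: spow_def)

lemma spow_minus: "spow q (- u) = - spow q u"
  by (simp add: spow_def)

lemma spow_nonpos: "u \<le> 0 \<Longrightarrow> spow q u = - ((- u) powr q)"
  by (simp add: spow_def)

lemma spow_zero [simp]: "spow q 0 = 0"
  by (simp add: spow_def)

lemma continuous_on_spow:
  assumes "0 < q"
  shows "continuous_on S (spow q)"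
  unfolding spow_def using assms by (intro continuous_intros continuous_on_powr') auto

lemma spow_strict_mono:
  assumes "0 < q" "u < v"
  shows "spow q u < spow q v"
proof -
  have "max u 0 powr q \<le> max v 0 powr q" "max (- v) 0 powr q \<le> max (- u) 0 powr q"
    using assms by (auto intro!: powr_mono2)
  moreover have "max u 0 powr q < max v 0 powr q \<or> max (- v) 0 powr q < max (- u) 0 powr q"
  proof (cases "0 < v")
    case True
    then have "max u 0 powr q < max v 0 powr q" using assms by (intro powr_less_mono2) auto
    then show ?thesis ..
  next
    case False
    then have "max (- v) 0 powr q < max (- u) 0 powr q"
      using assms by (intro powr_less_mono2) auto
    then show ?thesis ..
  qed
  ultimately show ?thesis by (auto simp: spow_def)
qed

lemma spow_mono: "0 < q \<Longrightarrow> u \<le> v \<Longrightarrow> spow q u \<le> spow q v"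
  using spow_strict_mono[of q u v] by (cases "u = v") auto

lemma spow_mult_self: "spow (p - 1) u * u = \<bar>u\<bar> powr p"
proof (cases "u = 0")
  case False
  then have "\<bar>u\<bar> powr (p - 1) * \<bar>u\<bar> = \<bar>u\<bar> powr p"
    by (simp add: powr_mult_base' powr_diff)
  then show ?thesis
    by (cases "0 \<le> u") (auto simp: spow_nonneg spow_nonpos)
qed simp

lemma DERIV_abs_powr:
  assumes "1 < p"
  shows "DERIV (\<lambda>u. \<bar>u\<bar> powr p) u :> p * spow (p - 1) u"
proof -
  consider "0 < u" | "u < 0" | "u = 0" by linarith
  then show ?thesis
  proof cases
    case 1
    have "DERIV (\<lambda>u. u powr p) u :> p * spow (p - 1) u"
      using 1 by (auto intro!: derivative_eq_intros simp: spow_nonneg powr_diff field_simps)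
    then show ?thesis
      by (rule has_field_derivative_transform_within_open[of _ _ _ "{0<..}"]) (use 1 in auto)
  next
    case 2
    have "DERIV (\<lambda>u. (- u) powr p) u :> p * spow (p - 1) u"
      using 2 by (auto intro!: derivative_eq_intros
          simp: spow_nonpos powr_diff field_simps)
    then show ?thesis
      by (rule has_field_derivative_transform_within_open[of _ _ _ "{..<0}"]) (use 2 in auto)
  next
    case 3
    \<comment> \<open>At 0 the factor in Caratheodory's criterion is \<open>spow (p - 1)\<close>
      itself, so its continuity suffices.\<close>
    have "isCont (spow (p - 1)) 0"
      using continuous_on_spow[of "p - 1" UNIV] assms
      by (simp add: continuous_on_eq_continuous_at)
    then show ?thesis
      unfolding CARAT_DERIV 3 by (intro exI[of _ "spow (p - 1)"]) (simp add: spow_mult_self)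
  qed
qed

text \<open>The derivative is increasing, so the mean value theorem puts the graph above its
  tangents. Convexity, uniform smoothness and the lower bound in \<open>best_decrease\<close> all
  rest on this inequality.\<close>

lemma abs_powr_tangent:
  assumes "1 < p"
  shows "\<bar>u\<bar> powr p + p * spow (p - 1) u * (v - u) \<le> \<bar>v\<bar> powr p"
proof (cases u v rule: linorder_cases)
  case less
  obtain c where c: "u < c" "\<bar>v\<bar> powr p - \<bar>u\<bar> powr p = (v - u) * (p * spow (p - 1) c)"
    using MVT2[OF less, of "\<lambda>u. \<bar>u\<bar> powr p" "\<lambda>u. p * spow (p - 1) u"]
      DERIV_abs_powr[OF assms] by auto
  have "(v - u) * (p * spow (p - 1) u) \<le> (v - u) * (p * spow (p - 1) c)"
    using less c assms spow_mono[of "p - 1" u c] by (intro mult_left_mono) auto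
  then show ?thesis using c by (simp add: algebra_simps)
next
  case equal
  then show ?thesis by simp
next
  case greater
  obtain c where c: "c < u" "\<bar>u\<bar> powr p - \<bar>v\<bar> powr p = (u - v) * (p * spow (p - 1) c)"
    using MVT2[OF greater, of "\<lambda>u. \<bar>u\<bar> powr p" "\<lambda>u. p * spow (p - 1) u"]
      DERIV_abs_powr[OF assms] by auto
  have "(u - v) * (p * spow (p - 1) c) \<le> (u - v) * (p * spow (p - 1) u)"
    using greater c assms spow_mono[of "p - 1" c u] by (intro mult_left_mono) auto
  then show ?thesis using c by (simp add: algebra_simps)
qed

text \<open>The tangent inequality at \<open>x = a * u + b * v\<close> is averaged with weights
  \<open>a\<close> and \<open>b\<close>; the linear terms cancel.\<close>

lemma abs_powr_convex:
  fixes p u v :: real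
  assumes "1 < p" "0 \<le> a" "0 \<le> b" "a + b = 1"
  shows "\<bar>a * u + b * v\<bar> powr p \<le> a * \<bar>u\<bar> powr p + b * \<bar>v\<bar> powr p"
proof -
  define x where "x = a * u + b * v"
  define D where "D = p * spow (p - 1) x"
  have "a * (\<bar>x\<bar> powr p + D * (u - x)) + b * (\<bar>x\<bar> powr p + D * (v - x))
      \<le> a * \<bar>u\<bar> powr p + b * \<bar>v\<bar> powr p"
    unfolding D_def using assms by (intro add_mono mult_left_mono abs_powr_tangent) auto
  moreover have "a * (\<bar>x\<bar> powr p + D * (u - x)) + b * (\<bar>x\<bar> powr p + D * (v - x))
      = (a + b) * \<bar>x\<bar> powr p + D * (x - (a + b) * x)"
    by (simp add: x_def algebra_simps)
  ultimately show ?thesis using assms(4) by (simp add: x_def)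
qed

text \<open>Uniform smoothness of the scalar function: the tangents at \<open>u + s\<close> and
  \<open>u - s\<close> bound the second difference by the variation of the derivative between these
  points, which is uniformly small on a bounded interval.\<close>

lemma abs_powr_second_difference:
  fixes p \<epsilon> R :: real
  assumes "1 < p" "0 < \<epsilon>"
  shows "\<exists>\<tau>>0. \<forall>u s. \<bar>u\<bar> \<le> R \<longrightarrow> \<bar>s\<bar> \<le> \<tau> \<longrightarrow>
    \<bar>u + s\<bar> powr p + \<bar>u - s\<bar> powr p \<le> 2 * \<bar>u\<bar> powr p + \<epsilon> * \<bar>s\<bar>"
proof -
  have "uniformly_continuous_on {-(R + 1)..R + 1} (spow (p - 1))"
    using assms by (intro compact_uniformly_continuous continuous_on_spow) auto
  moreover have "0 < \<epsilon> / p" using assms by simp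
  ultimately obtain d where d: "0 < d" and
    dd: "\<And>x y. x \<in> {-(R + 1)..R + 1} \<Longrightarrow> y \<in> {-(R + 1)..R + 1} \<Longrightarrow> dist y x < d \<Longrightarrow>
      dist (spow (p - 1) y) (spow (p - 1) x) < \<epsilon> / p"
    unfolding uniformly_continuous_on_def by blast
  \<comment> \<open>The bound 1 keeps \<open>u + s\<close> and \<open>u - s\<close> within radius
    \<open>R + 1\<close>, and \<open>d / 3\<close> makes their distance less than
    \<open>d\<close>.\<close>
  define \<tau> where "\<tau> = min 1 (d / 3)"
  have "\<bar>u + s\<bar> powr p + \<bar>u - s\<bar> powr p \<le> 2 * \<bar>u\<bar> powr p + \<epsilon> * \<bar>s\<bar>"
    if "\<bar>u\<bar> \<le> R" "\<bar>s\<bar> \<le> \<tau>" for u s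
  proof -
    have 1: "\<bar>u + s\<bar> powr p + p * spow (p - 1) (u + s) * (u - (u + s)) \<le> \<bar>u\<bar> powr p"
      by (rule abs_powr_tangent[OF assms(1)])
    have 2: "\<bar>u - s\<bar> powr p + p * spow (p - 1) (u - s) * (u - (u - s)) \<le> \<bar>u\<bar> powr p"
      by (rule abs_powr_tangent[OF assms(1)])
    have "dist (spow (p - 1) (u + s)) (spow (p - 1) (u - s)) < \<epsilon> / p"
      using that d by (intro dd) (auto simp: \<tau>_def dist_real_def)
    then have "p * \<bar>spow (p - 1) (u + s) - spow (p - 1) (u - s)\<bar> \<le> \<epsilon>"
      using assms by (simp add: dist_real_def field_simps)
    then have "\<bar>p * (spow (p - 1) (u + s) - spow (p - 1) (u - s))\<bar> \<le> \<epsilon>"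
      using assms by (simp only: abs_mult)
    then have "\<bar>p * (spow (p - 1) (u + s) - spow (p - 1) (u - s)) * s\<bar> \<le> \<epsilon> * \<bar>s\<bar>"
      unfolding abs_mult[of _ s] by (intro mult_right_mono) auto
    then have "p * (spow (p - 1) (u + s) - spow (p - 1) (u - s)) * s \<le> \<epsilon> * \<bar>s\<bar>"
      by (rule abs_le_D1)
    then show ?thesis using 1 2 by (simp add: algebra_simps)
  qed
  moreover have "0 < \<tau>" using d by (simp add: \<tau>_def)
  ultimately show ?thesis by blast
qed

section \<open>Norm-decreasing coordinate steps\<close>

text \<open>The axioms retain what the counting argument needs: a step is Lipschitz, moves along
  \<open>e i\<close>, and deletes the top coordinate. Neither minimization nor a selection rule
  appears.\<close>

locale coordinate_steps =
  fixes nrm :: "'a::real_vector \<Rightarrow> real"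
    and e :: "nat \<Rightarrow> 'a"
    and T :: "nat \<Rightarrow> 'a \<Rightarrow> 'a"
    and L :: real
    and M :: nat
  assumes nrm_zero: "nrm 0 = 0"
    and nrm_minus: "nrm (- x) = nrm x"
    and nrm_triangle: "nrm (x + y) \<le> nrm x + nrm y"
    and L_ge_1: "1 \<le> L"
    and T_lipschitz: "i < M \<Longrightarrow> nrm (T i x - T i y) \<le> L * nrm (x - y)"
    and T_direction: "i < M \<Longrightarrow> \<exists>c. T i x = x - c *\<^sub>R e i"
    and T_project: "k < M \<Longrightarrow> z \<in> span (e ` {..<k}) \<Longrightarrow> T k (z + a *\<^sub>R e k) = z"
begin

abbreviation X :: "nat \<Rightarrow> 'a set"
  where "X k \<equiv> span (e ` {..<k})"

lemma X_Suc: "y \<in> X (Suc k) \<longleftrightarrow> (\<exists>a. y - a *\<^sub>R e k \<in> X k)"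
  by (simp add: lessThan_Suc span_breakdown_eq)

lemma X_mono: "j \<le> k \<Longrightarrow> X j \<subseteq> X k"
  by (intro span_mono image_mono) auto

text \<open>This is \<open>T_project\<close> with \<open>a = 0\<close>: a direction beyond the
  current span cannot reduce a positive norm.\<close>

lemma T_fixed: "y \<in> X k \<Longrightarrow> k \<le> i \<Longrightarrow> i < M \<Longrightarrow> T i y = y"
  using T_project[of i y 0] X_mono[of k i] by auto

lemma T_in_X:
  assumes "y \<in> X k" "i < M"
  shows "T i y \<in> X k"
proof (cases "i < k")
  case True
  obtain c where "T i y = y - c *\<^sub>R e i" using T_direction assms(2) by blast
  then show ?thesis using assms True by (auto intro!: span_diff span_scale intro: span_base)
next
  case False
  then show ?thesis using assms by (simp add: T_fixed)
qed

lemma T_last_in_X: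
  assumes "y \<in> X (Suc k)" "k < M"
  shows "T k y \<in> X k"
proof -
  obtain a where a: "y - a *\<^sub>R e k \<in> X k" using assms X_Suc by blast
  show ?thesis using T_project[OF assms(2) a, of a] a by simp
qed

lemma nrm_diff: "nrm (x - y) \<le> nrm x + nrm y"
  using nrm_triangle[of x "- y"] by (simp add: nrm_minus)

lemma nrm_T_le: "i < M \<Longrightarrow> nrm (T i y) \<le> L * nrm y"
  using T_lipschitz[of i y 0] T_fixed[of 0 0 i] by simp

lemma nrm_nonneg: "0 \<le> nrm x"
  using nrm_diff[of x x] by (simp add: nrm_zero)

text \<open>The part along \<open>e k\<close> equals \<open>y - T k y\<close>, because
  \<open>T k\<close> deletes it. Lipschitz steps thus yield bounded coordinate projections.\<close>

lemma nrm_last_coordinate_le: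
  assumes "y - a *\<^sub>R e k \<in> X k" "k < M"
  shows "nrm (a *\<^sub>R e k) \<le> (1 + L) * nrm y"
proof -
  have "T k y = y - a *\<^sub>R e k" using T_project[OF assms(2,1), of a] by simp
  then have "nrm (a *\<^sub>R e k) = nrm (y - T k y)" by simp
  then show ?thesis using nrm_diff[of y "T k y"] nrm_T_le[OF assms(2), of y]
    by (simp add: algebra_simps)
qed

text \<open>The factor \<theta> is recorded, but not the rule that picks the directions. Positive
  norms exclude the trivial continuation at norm 0, which could have any length.\<close>

definition reducing_run :: "nat \<Rightarrow> real \<Rightarrow> nat \<Rightarrow> (nat \<Rightarrow> 'a) \<Rightarrow> bool"
  where "reducing_run k \<theta> n y \<longleftrightarrow> y 0 \<in> X k \<and> (\<forall>j\<le>n. 0 < nrm (y j)) \<and>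
    (\<forall>j<n. \<exists>i<M. y (Suc j) = T i (y j) \<and> nrm (y (Suc j)) \<le> \<theta> * nrm (y j))"

lemma reducing_run_in_X:
  assumes "reducing_run k \<theta> n y" "j \<le> n"
  shows "y j \<in> X k"
  using assms(2)
proof (induction j)
  case 0
  then show ?case using assms(1) by (simp add: reducing_run_def)
next
  case (Suc j)
  then show ?case using assms(1) T_in_X unfolding reducing_run_def
    by (metis Suc_le_lessD less_imp_le_nat)
qed

lemma reducing_run_shift:
  assumes "reducing_run k \<theta> n y" "y s \<in> X k'" "s + n' \<le> n"
  shows "reducing_run k' \<theta> n' (\<lambda>j. y (s + j))"
  using assms unfolding reducing_run_def by auto

lemma reducing_run_decay:
  assumes "reducing_run k \<theta> n y" "s + j \<le> n" "0 \<le> \<theta>"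
  shows "nrm (y (s + j)) \<le> \<theta> ^ j * nrm (y s)"
  using assms(2)
proof (induction j)
  case 0
  then show ?case by simp
next
  case (Suc j)
  then have "nrm (y (Suc (s + j))) \<le> \<theta> * nrm (y (s + j))"
    using assms(1) unfolding reducing_run_def by (metis add_Suc_right Suc_le_lessD)
  also have "\<dots> \<le> \<theta> * (\<theta> ^ j * nrm (y s))"
    using Suc assms(3) by (intro mult_left_mono) auto
  finally show ?case by simp
qed

text \<open>The same directions are applied to \<open>y 0\<close> without its part along
  \<open>e k\<close>. The distance of the two sequences grows at most by the factor \<open>L\<close>
  per step, so \<open>small\<close> keeps it below the fraction \<epsilon> of
  \<open>nrm (y j)\<close>. The reduction factor then becomes at most
  \<open>(\<theta> + L * \<epsilon>) / (1 - \<epsilon>)\<close>, which is at most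
  \<open>(1 + \<theta>) / 2\<close>.\<close>

lemma shadow_reducing_run:
  assumes run: "reducing_run (Suc k) \<theta> n y"
    and idx: "\<And>j. j < n \<Longrightarrow> i j < M \<and> y (Suc j) = T (i j) (y j)"
    and a: "y 0 - a *\<^sub>R e k \<in> X k"
    and \<epsilon>: "0 \<le> \<epsilon>" "(L + 1) * \<epsilon> \<le> (1 - \<theta>) / 4" "0 < \<theta>" "\<theta> < 1"
    and small: "\<And>j. j \<le> n \<Longrightarrow> L ^ n * nrm (a *\<^sub>R e k) \<le> \<epsilon> * nrm (y j)"
  shows "\<exists>z. reducing_run k ((1 + \<theta>) / 2) n z"
proof -
  define z where "z = rec_nat (y 0 - a *\<^sub>R e k) (\<lambda>j. T (i j))"
  have z0: "z 0 = y 0 - a *\<^sub>R e k" and zS: "z (Suc j) = T (i j) (z j)" for j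
    by (simp_all add: z_def)
  have dist: "nrm (y j - z j) \<le> L ^ j * nrm (a *\<^sub>R e k)" if "j \<le> n" for j
    using that
  proof (induction j)
    case 0
    then show ?case by (simp add: z0)
  next
    case (Suc j)
    have "nrm (y (Suc j) - z (Suc j)) \<le> L * nrm (y j - z j)"
      using idx[of j] Suc.prems T_lipschitz zS by auto
    also have "\<dots> \<le> L * (L ^ j * nrm (a *\<^sub>R e k))"
      using Suc L_ge_1 by (intro mult_left_mono) auto
    finally show ?case by simp
  qed
  have close: "nrm (y j - z j) \<le> \<epsilon> * nrm (y j)" if "j \<le> n" for j
  proof -
    have "L ^ j * nrm (a *\<^sub>R e k) \<le> L ^ n * nrm (a *\<^sub>R e k)"
      using that L_ge_1 nrm_nonneg by (intro mult_right_mono power_increasing)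
    then show ?thesis using dist[OF that] small[OF that] by linarith
  qed
  have "2 * \<epsilon> \<le> (L + 1) * \<epsilon>" using L_ge_1 \<epsilon>(1) by (intro mult_right_mono) auto
  then have \<epsilon>1: "\<epsilon> < 1" using \<epsilon> by simp
  have lower: "(1 - \<epsilon>) * nrm (y j) \<le> nrm (z j)" if "j \<le> n" for j
    using nrm_triangle[of "z j" "y j - z j"] close[OF that] by (simp add: algebra_simps)
  have pos: "0 < nrm (z j)" if "j \<le> n" for j
  proof -
    have "0 < nrm (y j)" using run that unfolding reducing_run_def by simp
    then have "0 < (1 - \<epsilon>) * nrm (y j)" using \<epsilon>1 by simp
    then show ?thesis using lower[OF that] by linarith
  qed
  have step: "nrm (z (Suc j)) \<le> (1 + \<theta>) / 2 * nrm (z j)" if "j < n" for j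
  proof -
    have y: "nrm (y (Suc j)) \<le> \<theta> * nrm (y j)"
      using run that unfolding reducing_run_def by auto
    have "nrm (z (Suc j)) \<le> nrm (y (Suc j)) + nrm (y (Suc j) - z (Suc j))"
      using nrm_diff[of "y (Suc j)" "y (Suc j) - z (Suc j)"] by simp
    also have "nrm (y (Suc j) - z (Suc j)) \<le> L * nrm (y j - z j)"
      using idx[OF that] T_lipschitz zS by auto
    also have "\<dots> \<le> L * (\<epsilon> * nrm (y j))"
      using close[of j] that L_ge_1 by (intro mult_left_mono) auto
    finally have "nrm (z (Suc j)) \<le> (\<theta> + L * \<epsilon>) * nrm (y j)"
      using y by (simp add: algebra_simps)
    also have "\<dots> \<le> ((1 + \<theta>) / 2 * (1 - \<epsilon>)) * nrm (y j)"
    proof (intro mult_right_mono nrm_nonneg)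
      have "\<theta> * \<epsilon> \<le> 1 * \<epsilon>" using \<epsilon> by (intro mult_right_mono) auto
      then show "\<theta> + L * \<epsilon> \<le> (1 + \<theta>) / 2 * (1 - \<epsilon>)" using \<epsilon> by (simp add: field_simps)
    qed
    also have "\<dots> = (1 + \<theta>) / 2 * ((1 - \<epsilon>) * nrm (y j))" by simp
    also have "\<dots> \<le> (1 + \<theta>) / 2 * nrm (z j)"
      using lower[of j] that \<epsilon> by (intro mult_left_mono) auto
    finally show ?thesis .
  qed
  have "reducing_run k ((1 + \<theta>) / 2) n z"
    unfolding reducing_run_def
  proof (intro conjI allI impI)
    show "z 0 \<in> X k" using z0 a by simp
  next
    fix j assume "j < n"
    then show "\<exists>i<M. z (Suc j) = T i (z j) \<and> nrm (z (Suc j)) \<le> (1 + \<theta>) / 2 * nrm (z j)"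
      using idx[of j] zS[of j] step[of j] by auto
  qed (use pos in auto)
  then show ?thesis by blast
qed

theorem reducing_runs_bounded:
  assumes "k \<le> M" "0 < \<theta>" "\<theta> < 1"
  shows "\<exists>n. \<forall>y. \<not> reducing_run k \<theta> n y"
  using assms
proof (induction k arbitrary: \<theta>)
  case 0
  then show ?case by (intro exI[of _ 0]) (auto simp: reducing_run_def nrm_zero)
next
  case (Suc k)
  have k: "k < M" using Suc.prems by simp
  \<comment> \<open>\<open>n0\<close> limits shadow runs, which have the weaker factor
    \<open>(1 + \<theta>) / 2\<close>; \<open>n1\<close> limits what remains once direction
    \<open>k\<close> has been chosen.\<close>
  obtain n0 where n0: "\<not> reducing_run k ((1 + \<theta>) / 2) n0 y" for y
    using Suc.IH[of "(1 + \<theta>) / 2"] Suc.prems by auto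
  obtain n1 where n1: "\<not> reducing_run k \<theta> n1 y" for y
    using Suc.IH[of \<theta>] Suc.prems by auto
  define \<epsilon> where "\<epsilon> = (1 - \<theta>) / (4 * (L + 1))"
  have \<epsilon>: "0 < \<epsilon>" "(L + 1) * \<epsilon> \<le> (1 - \<theta>) / 4"
    using Suc.prems L_ge_1 by (auto simp: \<epsilon>_def field_simps)
  \<comment> \<open>\<open>C\<close> collects the losses in the final comparison:
    \<open>L ^ n0\<close> from the shadow and \<open>1 + L\<close> from the bound on the last
    coordinate. The decay over \<open>K\<close> steps outweighs them.\<close>
  define C where "C = L ^ n0 * (1 + L)"
  have C: "0 < C" using L_ge_1 by (auto simp: C_def intro!: mult_pos_pos)
  obtain K where K: "\<theta> ^ K < \<epsilon> / C"
    using real_arch_pow_inv[of "\<epsilon> / C" \<theta>] \<epsilon> C Suc.prems by auto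
  define n2 where "n2 = n0 + K + 1"
  have "\<not> reducing_run (Suc k) \<theta> (n2 + n1) y" for y
  proof
    assume run: "reducing_run (Suc k) \<theta> (n2 + n1) y"
    obtain i where i: "\<And>j. j < n2 + n1 \<Longrightarrow> i j < M \<and> y (Suc j) = T (i j) (y j) \<and>
        nrm (y (Suc j)) \<le> \<theta> * nrm (y j)"
      using run unfolding reducing_run_def by metis
    have yX: "y j \<in> X (Suc k)" if "j \<le> n2 + n1" for j
      using reducing_run_in_X[OF run that] .
    have pos: "0 < nrm (y j)" if "j \<le> n2 + n1" for j
      using run that unfolding reducing_run_def by simp
    \<comment> \<open>If direction \<open>k\<close> occurred here, the vector would land in
      \<open>X k\<close> with at least \<open>n1\<close> steps still to come. A direction beyond
      \<open>k\<close> would leave the norm unchanged.\<close>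
    have ik: "i j < k" if "j < n2" for j
    proof (rule ccontr)
      assume "\<not> i j < k"
      then consider "i j = k" | "Suc k \<le> i j" by linarith
      then show False
      proof cases
        case 1
        then have "y (Suc j) \<in> X k" using i[of j] that yX[of j] T_last_in_X k by auto
        then have "reducing_run k \<theta> n1 (\<lambda>l. y (Suc j + l))"
          using reducing_run_shift[OF run, of "Suc j" k n1] that by simp
        then show False using n1 by blast
      next
        case 2
        then have "y (Suc j) = y j" using i[of j] that yX[of j] T_fixed by auto
        then have "nrm (y j) \<le> \<theta> * nrm (y j)" using i[of j] that by (metis trans_less_add1)
        moreover have "\<theta> * nrm (y j) < 1 * nrm (y j)"
          using pos[of j] that Suc.prems by (intro mult_strict_right_mono) auto
        ultimately show False by simp
      qed
    qed
    obtain a where a: "y 0 - a *\<^sub>R e k \<in> X k" using yX[of 0] X_Suc by blast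
    \<comment> \<open>Directions below \<open>k\<close> do not touch the coefficient along
      \<open>e k\<close>.\<close>
    have aj: "y j - a *\<^sub>R e k \<in> X k" if "j \<le> n2" for j
      using that
    proof (induction j)
      case 0
      then show ?case using a by simp
    next
      case (Suc j)
      obtain c where c: "y (Suc j) = y j - c *\<^sub>R e (i j)"
        using i[of j] T_direction Suc.prems
        by (metis Suc_le_lessD trans_less_add1)
      have "e (i j) \<in> X k" using Suc.prems ik[of j] by (auto intro: span_base)
      then have "(y j - a *\<^sub>R e k) - c *\<^sub>R e (i j) \<in> X k"
        using Suc by (simp add: span_diff span_scale)
      then show ?case by (simp add: c algebra_simps)
    qed
    have \<alpha>: "nrm (a *\<^sub>R e k) \<le> (1 + L) * nrm (y j)" if "j \<le> n2" for j
      using nrm_last_coordinate_le[OF aj[OF that] k] .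
    \<comment> \<open>Otherwise the first \<open>n0\<close> steps would have a shadow in
      \<open>X k\<close> of forbidden length.\<close>
    have "\<exists>j\<le>n0. \<epsilon> * nrm (y j) < L ^ n0 * nrm (a *\<^sub>R e k)"
    proof (rule ccontr)
      assume *: "\<not> ?thesis"
      have "reducing_run (Suc k) \<theta> n0 y"
        using reducing_run_shift[OF run, of 0 "Suc k" n0] yX[of 0] by (simp add: n2_def)
      then have "\<exists>z. reducing_run k ((1 + \<theta>) / 2) n0 z"
        by (rule shadow_reducing_run[where i = i and a = a and \<epsilon> = \<epsilon>])
          (use * i a \<epsilon> Suc.prems in \<open>auto simp: n2_def not_less\<close>)
      then show False using n0 by blast
    qed
    then obtain j where j: "j \<le> n0" "\<epsilon> * nrm (y j) < L ^ n0 * nrm (a *\<^sub>R e k)" by blast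
    have jK: "j + K \<le> n2" using j by (simp add: n2_def)
    \<comment> \<open>The coefficient \<open>a\<close> is the same \<open>K\<close> steps later,
      while the norm has decayed too far to dominate it as \<open>nrm_last_coordinate_le\<close>
      demands.\<close>
    have "L ^ n0 * nrm (a *\<^sub>R e k) \<le> L ^ n0 * ((1 + L) * nrm (y (j + K)))"
      using \<alpha>[OF jK] L_ge_1 by (intro mult_left_mono) auto
    also have "\<dots> = C * nrm (y (j + K))" by (simp add: C_def)
    also have "\<dots> \<le> C * (\<theta> ^ K * nrm (y j))"
      using reducing_run_decay[OF run, of j K] jK Suc.prems C by (intro mult_left_mono) auto
    also have "\<dots> \<le> C * (\<epsilon> / C * nrm (y j))"
      using K C nrm_nonneg by (intro mult_left_mono mult_right_mono) auto
    also have "\<dots> = \<epsilon> * nrm (y j)" using C by simp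
    finally show False using j by simp
  qed
  then show ?case by blast
qed

end

section \<open>Chains of functions in a finite weighted Lp space\<close>

text \<open>A discrete model of the Haar system: points of \<open>A\<close> stand for cells of equal
  measure \<open>w\<close>. \<open>e_const\<close> and \<open>e_sum\<close> are the two facts behind
  \<open>T_projects\<close>. Functions may have values off \<open>A\<close>, so the norm below is
  only a seminorm.\<close>

locale lp_chain =
  fixes A :: "'b set"
    and w p :: real
    and e :: "nat \<Rightarrow> 'b \<Rightarrow> real"
    and m :: nat
  assumes finite_A: "finite A"
    and w_pos: "0 < w"
    and p_gt_1: "1 < p"
    and e_nonzero: "i \<le> m \<Longrightarrow> \<exists>t\<in>A. e i t \<noteq> 0"
    and e_const: "i < j \<Longrightarrow> j \<le> m \<Longrightarrow> s \<in> A \<Longrightarrow> t \<in> A \<Longrightarrow> e j s \<noteq> 0 \<Longrightarrow> e j t \<noteq> 0 \<Longrightarrow>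
      e i s = e i t"
    and e_sum: "0 < j \<Longrightarrow> j \<le> m \<Longrightarrow> (\<Sum>t\<in>A. e j t) = 0"
begin

section \<open>The weighted Lp norm on \<open>A\<close> and its comparison with the supremum
  norm\<close>

definition lnorm :: "('b \<Rightarrow> real) \<Rightarrow> real"
  where "lnorm y = (w * (\<Sum>t\<in>A. \<bar>y t\<bar> powr p)) powr (1 / p)"

lemma fun_apply [simp]:
  fixes x y :: "'b \<Rightarrow> real"
  shows "(x + y) t = x t + y t" "(x - y) t = x t - y t" "(- x) t = - x t"
    "(c *\<^sub>R y) t = c * y t" "(0 :: 'b \<Rightarrow> real) t = 0"
  by (simp_all add: scaleR_fun_def)

lemma lnorm_nonneg [simp]: "0 \<le> lnorm y"
  by (simp add: lnorm_def)

lemma lnorm_powr: "lnorm y powr p = w * (\<Sum>t\<in>A. \<bar>y t\<bar> powr p)"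
  using w_pos p_gt_1 by (simp add: lnorm_def powr_powr sum_nonneg)

lemma lnorm_le_iff: "0 \<le> c \<Longrightarrow> lnorm y \<le> c \<longleftrightarrow> lnorm y powr p \<le> c powr p"
  using p_gt_1 powr_mono2[of p "lnorm y" c] powr_less_mono2[of p c "lnorm y"]
  by (auto simp: not_le[symmetric])

lemma lnorm_scaleR: "lnorm (c *\<^sub>R y) = \<bar>c\<bar> * lnorm y"
proof -
  have "w * (\<Sum>t\<in>A. \<bar>(c *\<^sub>R y) t\<bar> powr p) = \<bar>c\<bar> powr p * (w * (\<Sum>t\<in>A. \<bar>y t\<bar> powr p))"
    by (simp add: abs_mult powr_mult sum_distrib_left mult_ac)
  then show ?thesis using p_gt_1 w_pos by (simp add: lnorm_def powr_mult powr_powr sum_nonneg)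
qed

lemma lnorm_eq_0_iff: "lnorm y = 0 \<longleftrightarrow> (\<forall>t\<in>A. y t = 0)"
  using finite_A w_pos by (auto simp: lnorm_def sum_nonneg_eq_0_iff)

text \<open>Minkowski's inequality from convexity: \<open>x\<close> and \<open>y\<close> are
  normalized and combined with weights \<open>a / (a + b)\<close> and \<open>b / (a + b)\<close>.
  The case where one of them vanishes on \<open>A\<close> is separate.\<close>

lemma lnorm_triangle: "lnorm (x + y) \<le> lnorm x + lnorm y"
proof (cases "lnorm x = 0 \<or> lnorm y = 0")
  case True
  then have "(\<forall>t\<in>A. (x + y) t = y t) \<or> (\<forall>t\<in>A. (x + y) t = x t)"
    by (auto simp: lnorm_eq_0_iff)
  then have "lnorm (x + y) = lnorm y \<or> lnorm (x + y) = lnorm x"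
    unfolding lnorm_def by (metis (no_types, lifting) sum.cong)
  then show ?thesis using lnorm_nonneg[of x] lnorm_nonneg[of y] by linarith
next
  case False
  define a b where "a = lnorm x" and "b = lnorm y"
  have pos: "0 < a" "0 < b" using False by (auto simp: a_def b_def less_le)
  have pt: "\<bar>(x t + y t) / (a + b)\<bar> powr p
      \<le> a / (a + b) * \<bar>x t / a\<bar> powr p + b / (a + b) * \<bar>y t / b\<bar> powr p" for t
  proof -
    have "a / (a + b) + b / (a + b) = 1" using pos by (simp add: add_divide_distrib[symmetric])
    then show ?thesis
      using abs_powr_convex[OF p_gt_1, of "a / (a + b)" "b / (a + b)" "x t / a" "y t / b"] pos
      by (simp add: add_divide_distrib)
  qed
  have unit: "w * (\<Sum>t\<in>A. \<bar>v t / lnorm v\<bar> powr p) = 1" if "0 < lnorm v" for v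
  proof -
    have "w * (\<Sum>t\<in>A. \<bar>v t / lnorm v\<bar> powr p) = lnorm ((1 / lnorm v) *\<^sub>R v) powr p"
      by (simp add: lnorm_powr)
    also have "\<dots> = 1" using that by (simp add: lnorm_scaleR)
    finally show ?thesis .
  qed
  have "lnorm ((1 / (a + b)) *\<^sub>R (x + y)) powr p = w * (\<Sum>t\<in>A. \<bar>(x t + y t) / (a + b)\<bar> powr p)"
    by (simp add: lnorm_powr)
  also have "\<dots> \<le> w * (\<Sum>t\<in>A. a / (a + b) * \<bar>x t / a\<bar> powr p + b / (a + b) * \<bar>y t / b\<bar> powr p)"
    using w_pos by (intro mult_left_mono sum_mono pt) auto
  also have "\<dots> = a / (a + b) * (w * (\<Sum>t\<in>A. \<bar>x t / a\<bar> powr p))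
      + b / (a + b) * (w * (\<Sum>t\<in>A. \<bar>y t / b\<bar> powr p))"
    by (simp add: sum.distrib sum_distrib_left algebra_simps)
  also have "\<dots> = a / (a + b) + b / (a + b)"
    using unit[of x] unit[of y] pos by (simp add: a_def b_def)
  also have "\<dots> = 1" using pos by (simp add: add_divide_distrib[symmetric])
  finally have "lnorm ((1 / (a + b)) *\<^sub>R (x + y)) \<le> 1"
    using lnorm_le_iff[of 1] by simp
  then have "\<bar>1 / (a + b)\<bar> * lnorm (x + y) \<le> 1" by (simp only: lnorm_scaleR)
  then show ?thesis using pos by (simp add: a_def b_def field_simps)
qed

text \<open>A single term is at most the whole sum. Together with \<open>lnorm_le_sup\<close> this
  gives access to pointwise estimates on \<open>A\<close>.\<close>

lemma abs_le_lnorm: "\<exists>c>0. \<forall>y. \<forall>t\<in>A. \<bar>y t\<bar> \<le> c * lnorm y"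
proof (intro exI[of _ "(1 / w) powr (1 / p)"] conjI allI ballI)
  show "0 < (1 / w) powr (1 / p)" using w_pos by simp
next
  fix y :: "'b \<Rightarrow> real" and t
  assume "t \<in> A"
  then have "\<bar>y t\<bar> powr p \<le> (\<Sum>t\<in>A. \<bar>y t\<bar> powr p)"
    by (intro member_le_sum finite_A) auto
  then have "\<bar>y t\<bar> powr p \<le> 1 / w * (w * (\<Sum>t\<in>A. \<bar>y t\<bar> powr p))" using w_pos by simp
  then have "(\<bar>y t\<bar> powr p) powr (1 / p) \<le> (1 / w * (w * (\<Sum>t\<in>A. \<bar>y t\<bar> powr p))) powr (1 / p)"
    using p_gt_1 by (intro powr_mono2) auto
  also have "\<dots> = (1 / w) powr (1 / p) * lnorm y"
    unfolding lnorm_def by (rule powr_mult)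
  finally show "\<bar>y t\<bar> \<le> (1 / w) powr (1 / p) * lnorm y"
    using p_gt_1 by (simp add: powr_powr)
qed

lemma lnorm_le_sup: "\<exists>c>0. \<forall>y s. 0 \<le> s \<longrightarrow> (\<forall>t\<in>A. \<bar>y t\<bar> \<le> s) \<longrightarrow> lnorm y \<le> c * s"
\<comment> \<open>The added 1 keeps the constant positive without an appeal to \<open>A\<close>
  being nonempty.\<close>
proof (intro exI[of _ "(w * real (card A) + 1) powr (1 / p)"] conjI allI impI)
  have pos: "0 < w * real (card A) + 1"
    using w_pos by (simp add: add_nonneg_pos)
  then show "0 < (w * real (card A) + 1) powr (1 / p)" by simp
  fix y :: "'b \<Rightarrow> real" and s
  assume s: "0 \<le> s" "\<forall>t\<in>A. \<bar>y t\<bar> \<le> s"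
  have "(\<Sum>t\<in>A. \<bar>y t\<bar> powr p) \<le> (\<Sum>t\<in>A. s powr p)"
    using s p_gt_1 by (intro sum_mono powr_mono2) auto
  then have "w * (\<Sum>t\<in>A. \<bar>y t\<bar> powr p) \<le> (w * real (card A)) * s powr p"
    using w_pos by simp
  also have "\<dots> \<le> (w * real (card A) + 1) * s powr p"
    by (intro mult_right_mono) auto
  finally have "lnorm y powr p \<le> (w * real (card A) + 1) * s powr p"
    by (simp only: lnorm_powr)
  also have "\<dots> = ((w * real (card A) + 1) powr (1 / p) * s) powr p"
    using pos s p_gt_1 by (simp add: powr_mult powr_powr)
  finally show "lnorm y \<le> (w * real (card A) + 1) powr (1 / p) * s"
    using s by (subst lnorm_le_iff) auto
qed

section \<open>Minimization along a single direction\<close>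

lemma e_lower: "\<exists>\<kappa>>0. \<forall>i\<le>m. \<forall>t\<in>A. e i t \<noteq> 0 \<longrightarrow> \<kappa> \<le> \<bar>e i t\<bar>"
proof -
  let ?S = "insert 1 ((\<lambda>(i, t). \<bar>e i t\<bar>) ` ({..m} \<times> A) - {0})"
  have fin: "finite ?S" using finite_A by simp
  have "Min ?S \<in> ?S" by (rule Min_in[OF fin]) auto
  then have "0 < Min ?S" by auto
  moreover have "Min ?S \<le> \<bar>e i t\<bar>" if "i \<le> m" "t \<in> A" "e i t \<noteq> 0" for i t
    using that by (intro Min_le[OF fin]) (auto intro!: image_eqI[of _ _ "(i, t)"])
  ultimately show ?thesis by blast
qed

lemma e_upper: "\<exists>K\<ge>1. \<forall>i\<le>m. \<forall>t\<in>A. \<bar>e i t\<bar> \<le> K"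
proof -
  let ?S = "insert 1 ((\<lambda>(i, t). \<bar>e i t\<bar>) ` ({..m} \<times> A))"
  have fin: "finite ?S" using finite_A by simp
  have "1 \<le> Max ?S" by (rule Max_ge[OF fin]) auto
  moreover have "\<bar>e i t\<bar> \<le> Max ?S" if "i \<le> m" "t \<in> A" for i t
    using that by (intro Max_ge[OF fin]) (auto intro!: image_eqI[of _ _ "(i, t)"])
  ultimately show ?thesis by blast
qed

text \<open>Up to a factor, the derivative of the \<open>p\<close>-th power of the norm of \<open>y - l e\<^sub>i\<close>.\<close>

definition slope :: "nat \<Rightarrow> ('b \<Rightarrow> real) \<Rightarrow> real \<Rightarrow> real"
  where "slope i y l = (\<Sum>t\<in>A. e i t * spow (p - 1) (y t - l * e i t))"

text \<open>At the smallest and the largest quotient \<open>y t / e i t\<close> on the support of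
  \<open>e i\<close>, all summands of the slope have one sign, so the intermediate value theorem
  gives a root between them.\<close>

lemma slope_root_exists:
  assumes "i \<le> m"
  shows "\<exists>l. slope i y l = 0"
proof -
  define B where "B = {t\<in>A. e i t \<noteq> 0}"
  have B: "finite B" "B \<noteq> {}" using finite_A e_nonzero[OF assms] by (auto simp: B_def)
  define a where "a = Min ((\<lambda>t. y t / e i t) ` B)"
  define b where "b = Max ((\<lambda>t. y t / e i t) ` B)"
  have ab: "a \<le> y t / e i t \<and> y t / e i t \<le> b" if "t \<in> B" for t
    using that B by (auto simp: a_def b_def)
  have "a \<le> b" using ab B by force
  have sign: "0 \<le> e i t * spow (p - 1) v" if "0 \<le> e i t * v" for t v
    using that spow_mono[of "p - 1" 0 v] spow_mono[of "p - 1" v 0] p_gt_1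
    by (auto simp: zero_le_mult_iff)
  have "0 \<le> slope i y a"
    unfolding slope_def
  proof (intro sum_nonneg sign)
    fix t assume "t \<in> A"
    show "0 \<le> e i t * (y t - a * e i t)"
    proof (cases "e i t = 0")
      case False
      then have "a \<le> y t / e i t" using ab \<open>t \<in> A\<close> by (simp add: B_def)
      then have "0 \<le> (e i t)\<^sup>2 * (y t / e i t - a)" by (intro mult_nonneg_nonneg) auto
      moreover have "(e i t)\<^sup>2 * (y t / e i t - a) = e i t * (y t - a * e i t)"
        using False by (simp add: power2_eq_square right_diff_distrib)
      ultimately show ?thesis by simp
    qed simp
  qed
  moreover have "0 \<le> - slope i y b"
    unfolding slope_def sum_negf[symmetric] mult_minus_right[symmetric] spow_minus[symmetric]
  proof (intro sum_nonneg sign)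
    fix t assume "t \<in> A"
    show "0 \<le> e i t * - (y t - b * e i t)"
    proof (cases "e i t = 0")
      case False
      then have "y t / e i t \<le> b" using ab \<open>t \<in> A\<close> by (simp add: B_def)
      then have "0 \<le> (e i t)\<^sup>2 * (b - y t / e i t)" by (intro mult_nonneg_nonneg) auto
      moreover have "(e i t)\<^sup>2 * (b - y t / e i t) = e i t * - (y t - b * e i t)"
        using False by (simp add: power2_eq_square right_diff_distrib)
      ultimately show ?thesis by simp
    qed simp
  qed
  moreover have "continuous_on {a..b} (slope i y)"
    unfolding slope_def
    by (intro continuous_on_sum continuous_on_mult continuous_on_const
        continuous_on_compose2[OF continuous_on_spow[of "p - 1" UNIV]] continuous_intros)
      (use p_gt_1 in auto)
  ultimately show ?thesis
    using IVT2'[of "slope i y" b 0 a] \<open>a \<le> b\<close> by auto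
qed

text \<open>A comparison principle: if \<open>a\<close> exceeded \<open>b + s / \<kappa>\<close>,
  then every summand with \<open>e i t \<noteq> 0\<close> would be strictly smaller for
  \<open>y\<close> at \<open>a\<close> than for \<open>z\<close> at \<open>b\<close>, and the two
  sums could not both be 0.\<close>

lemma slope_root_le:
  assumes "i \<le> m" and roots: "slope i y a = 0" "slope i z b = 0"
    and \<kappa>: "0 < \<kappa>" "\<And>t. t \<in> A \<Longrightarrow> e i t \<noteq> 0 \<Longrightarrow> \<kappa> \<le> \<bar>e i t\<bar>"
    and s: "0 \<le> s" "\<And>t. t \<in> A \<Longrightarrow> \<bar>y t - z t\<bar> \<le> s"
  shows "a \<le> b + s / \<kappa>"
proof (rule ccontr)
  assume "\<not> a \<le> b + s / \<kappa>"
  then have gap: "s / \<kappa> < a - b" by simp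
  have less: "e i t * spow (p - 1) (y t - a * e i t) < e i t * spow (p - 1) (z t - b * e i t)"
    if "t \<in> A" "e i t \<noteq> 0" for t
  proof -
    have "s = s / \<kappa> * \<kappa>" using \<kappa> by simp
    also have "\<dots> \<le> s / \<kappa> * \<bar>e i t\<bar>" using \<kappa> s that by (intro mult_left_mono) auto
    also have "\<dots> < (a - b) * \<bar>e i t\<bar>" using gap that by (intro mult_strict_right_mono) auto
    finally have g: "s < (a - b) * \<bar>e i t\<bar>" .
    show ?thesis
    proof (cases "0 < e i t")
      case True
      then have "y t - a * e i t < z t - b * e i t"
        using g s(2)[OF that(1)] by (simp add: algebra_simps)
      then show ?thesis
        using True p_gt_1 spow_strict_mono by (intro mult_strict_left_mono) auto
    next
      case False
      then have "z t - b * e i t < y t - a * e i t"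
        using g s(2)[OF that(1)] by (simp add: algebra_simps)
      then show ?thesis
        using False that p_gt_1 spow_strict_mono by (intro mult_strict_left_mono_neg) auto
    qed
  qed
  have "slope i y a < slope i z b"
    unfolding slope_def
  proof (rule sum_strict_mono_ex1[OF finite_A])
    show "\<forall>t\<in>A. e i t * spow (p - 1) (y t - a * e i t) \<le> e i t * spow (p - 1) (z t - b * e i t)"
      using less by (metis less_eq_real_def mult_zero_left)
    show "\<exists>t\<in>A. e i t * spow (p - 1) (y t - a * e i t) < e i t * spow (p - 1) (z t - b * e i t)"
      using less e_nonzero[OF assms(1)] by blast
  qed
  then show False using roots by simp
qed

lemma slope_root_lipschitz:
  assumes "i \<le> m" "slope i y a = 0" "slope i z b = 0"
    and "0 < \<kappa>" "\<And>t. t \<in> A \<Longrightarrow> e i t \<noteq> 0 \<Longrightarrow> \<kappa> \<le> \<bar>e i t\<bar>"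
    and "0 \<le> s" "\<And>t. t \<in> A \<Longrightarrow> \<bar>y t - z t\<bar> \<le> s"
  shows "\<bar>a - b\<bar> \<le> s / \<kappa>"
  using slope_root_le[OF assms] slope_root_le[OF assms(1,3,2,4,5,6)] assms(7)
  by (force simp: abs_minus_commute abs_le_iff)

lemma slope_root_unique:
  assumes "i \<le> m" "slope i y a = 0" "slope i y b = 0"
  shows "a = b"
proof -
  obtain \<kappa> where "0 < \<kappa>" "\<forall>i\<le>m. \<forall>t\<in>A. e i t \<noteq> 0 \<longrightarrow> \<kappa> \<le> \<bar>e i t\<bar>" using e_lower by blast
  then show ?thesis using slope_root_lipschitz[OF assms, of \<kappa> 0] assms(1) by auto
qed

text \<open>The step is defined by the critical equation, which has exactly one root for
  \<open>i \<le> m\<close>; \<open>minimizer_T\<close> identifies it with every norm-minimizing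
  step.\<close>

definition T :: "nat \<Rightarrow> ('b \<Rightarrow> real) \<Rightarrow> 'b \<Rightarrow> real"
  where "T i y = y - (THE l. slope i y l = 0) *\<^sub>R e i"

lemma T_eqI:
  assumes "i \<le> m" "slope i y l = 0"
  shows "T i y = y - l *\<^sub>R e i"
proof -
  have "(THE l. slope i y l = 0) = l"
    using assms slope_root_unique by (intro the_equality) auto
  then show ?thesis by (simp add: T_def)
qed

text \<open>The root moves by at most \<open>s / \<kappa>\<close> when \<open>y\<close> moves by at
  most \<open>s\<close> at each point of \<open>A\<close>; the pointwise estimate is then translated
  to \<open>lnorm\<close>.\<close>

lemma T_lipschitz_ex:
  "\<exists>L\<ge>1. \<forall>i\<le>m. \<forall>y z. lnorm (T i y - T i z) \<le> L * lnorm (y - z)"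
proof -
  obtain \<kappa> where \<kappa>: "0 < \<kappa>" "\<And>i t. i \<le> m \<Longrightarrow> t \<in> A \<Longrightarrow> e i t \<noteq> 0 \<Longrightarrow> \<kappa> \<le> \<bar>e i t\<bar>"
    using e_lower by blast
  obtain K where K: "1 \<le> K" "\<And>i t. i \<le> m \<Longrightarrow> t \<in> A \<Longrightarrow> \<bar>e i t\<bar> \<le> K" using e_upper by blast
  obtain c where c: "0 < c" "\<And>y t. t \<in> A \<Longrightarrow> \<bar>y t\<bar> \<le> c * lnorm y" using abs_le_lnorm by blast
  obtain d where d: "0 < d" "\<And>y s. 0 \<le> s \<Longrightarrow> (\<And>t. t \<in> A \<Longrightarrow> \<bar>y t\<bar> \<le> s) \<Longrightarrow> lnorm y \<le> d * s"
    using lnorm_le_sup by blast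
  define L where "L = max 1 (d * (c * (1 + K / \<kappa>)))"
  have "lnorm (T i y - T i z) \<le> L * lnorm (y - z)" if i: "i \<le> m" for i y z
  proof -
    define s where "s = c * lnorm (y - z)"
    have s: "0 \<le> s" "\<And>t. t \<in> A \<Longrightarrow> \<bar>y t - z t\<bar> \<le> s"
      using c(1) c(2)[of _ "y - z"] by (auto simp: s_def)
    obtain a where a: "slope i y a = 0" using slope_root_exists[OF i] by blast
    obtain b where b: "slope i z b = 0" using slope_root_exists[OF i] by blast
    have ab: "\<bar>a - b\<bar> \<le> s / \<kappa>"
      by (rule slope_root_lipschitz[OF i a b \<kappa>(1) \<kappa>(2)[OF i] s])
    have "\<bar>(T i y - T i z) t\<bar> \<le> s * (1 + K / \<kappa>)" if "t \<in> A" for t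
    proof -
      have "(T i y - T i z) t = (y t - z t) - (a - b) * e i t"
        by (simp add: T_eqI[OF i a] T_eqI[OF i b] algebra_simps)
      then have "\<bar>(T i y - T i z) t\<bar> \<le> \<bar>y t - z t\<bar> + \<bar>a - b\<bar> * \<bar>e i t\<bar>"
        by (metis abs_triangle_ineq4 abs_mult)
      also have "\<dots> \<le> s + s / \<kappa> * K"
        using s(2)[OF that] ab K(2)[OF i that] s(1) \<kappa>(1) by (intro add_mono mult_mono) auto
      finally show ?thesis by (simp add: algebra_simps)
    qed
    then have "lnorm (T i y - T i z) \<le> d * (s * (1 + K / \<kappa>))"
      using s(1) K(1) \<kappa>(1) by (intro d(2)) auto
    also have "\<dots> = (d * (c * (1 + K / \<kappa>))) * lnorm (y - z)" by (simp add: s_def)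
    also have "\<dots> \<le> L * lnorm (y - z)" by (intro mult_right_mono) (auto simp: L_def)
    finally show ?thesis .
  qed
  then show ?thesis by (intro exI[of _ L]) (auto simp: L_def)
qed

lemma span_const:
  assumes "z \<in> span (e ` {..<k})" "k \<le> m" "s \<in> A" "t \<in> A" "e k s \<noteq> 0" "e k t \<noteq> 0"
  shows "z s = z t"
  using assms(1)
proof (induction rule: span_induct_alt)
  case (step c x y)
  then obtain i where "i < k" "x = e i" by auto
  then show ?case using step assms e_const[of i k s t] by simp
qed simp

text \<open>Since \<open>z\<close> has a single value on the support of \<open>e k\<close>, its
  signed power factors out of the slope at \<open>a\<close>, leaving the sum of
  \<open>e k\<close>.\<close>

lemma T_projects:
  assumes "k \<le> m" "z \<in> span (e ` {..<k})"
  shows "T k (z + a *\<^sub>R e k) = z"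
proof -
  obtain s where s: "s \<in> A" "e k s \<noteq> 0" using e_nonzero[OF assms(1)] by blast
  have "slope k (z + a *\<^sub>R e k) a = (\<Sum>t\<in>A. e k t * spow (p - 1) (z t))"
    by (simp add: slope_def)
  also have "\<dots> = (\<Sum>t\<in>A. e k t * spow (p - 1) (z s))"
    using span_const[OF assms(2,1) _ s(1) _ s(2)] by (intro sum.cong) (auto, metis)
  also have "\<dots> = (\<Sum>t\<in>A. e k t) * spow (p - 1) (z s)"
    by (simp add: sum_distrib_right)
  \<comment> \<open>For \<open>k = 0\<close> the sum of \<open>e 0\<close> need not vanish, but then
    \<open>z = 0\<close>.\<close>
  also have "\<dots> = 0"
    using e_sum[of k] assms by (cases "k = 0") auto
  finally show ?thesis using T_eqI[OF assms(1)] by simp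
qed

text \<open>At a minimum the derivative of the \<open>p\<close>-th power of the norm is zero, and it
  is \<open>- p * w\<close> times the slope. Uniqueness of the root does the rest.\<close>

lemma minimizer_T:
  assumes "i \<le> m" and min: "\<And>\<mu>. lnorm (y - l *\<^sub>R e i) \<le> lnorm (y - \<mu> *\<^sub>R e i)"
  shows "y - l *\<^sub>R e i = T i y"
proof -
  let ?f = "\<lambda>l. \<Sum>t\<in>A. \<bar>y t - l * e i t\<bar> powr p"
  have f: "lnorm (y - l *\<^sub>R e i) powr p = w * ?f l" for l
    by (simp add: lnorm_powr)
  have "?f l \<le> ?f \<mu>" for \<mu>
  proof -
    have "lnorm (y - l *\<^sub>R e i) powr p \<le> lnorm (y - \<mu> *\<^sub>R e i) powr p"
      using min p_gt_1 by (intro powr_mono2) auto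
    then show ?thesis unfolding f using w_pos by simp
  qed
  moreover have "DERIV ?f l :> (\<Sum>t\<in>A. p * spow (p - 1) (y t - l * e i t) * (0 - 1 * e i t))"
    by (intro DERIV_sum DERIV_chain2[OF DERIV_abs_powr[OF p_gt_1]] DERIV_diff DERIV_const
        DERIV_cmult_right DERIV_ident)
  ultimately have "(\<Sum>t\<in>A. p * spow (p - 1) (y t - l * e i t) * (0 - 1 * e i t)) = 0"
    by (intro DERIV_local_min[where f = ?f and d = 1]) auto
  moreover have "(\<Sum>t\<in>A. p * spow (p - 1) (y t - l * e i t) * (0 - 1 * e i t)) = - (p * slope i y l)"
    by (simp add: slope_def sum_distrib_left sum_negf mult_ac)
  ultimately have "slope i y l = 0" using p_gt_1 by simp
  then show ?thesis using T_eqI[OF assms(1)] by simp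
qed

section \<open>Linear functionals on the span \<open>V\<close>\<close>

abbreviation V :: "('b \<Rightarrow> real) set"
  where "V \<equiv> span (e ` {0..m})"

lemma V_eq: "V = span (e ` {..<Suc m})"
  by (simp add: lessThan_Suc_atMost atLeast0AtMost)

lemma e_in_V: "i \<le> m \<Longrightarrow> e i \<in> V"
  by (intro span_base) auto

lemma lnorm_e_pos:
  assumes "i \<le> m"
  shows "0 < lnorm (e i)"
  using e_nonzero[OF assms] lnorm_eq_0_iff[of "e i"] lnorm_nonneg[of "e i"]
  by (auto simp: less_le)

lemma steps_ex: "\<exists>L. coordinate_steps lnorm e T L (Suc m)"
proof -
  obtain L where L: "1 \<le> L" "\<And>i y z. i \<le> m \<Longrightarrow> lnorm (T i y - T i z) \<le> L * lnorm (y - z)"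
    using T_lipschitz_ex by blast
  have "coordinate_steps lnorm e T L (Suc m)"
  proof
    show "lnorm 0 = 0" by (simp add: lnorm_eq_0_iff)
    show "lnorm (- x) = lnorm x" for x using lnorm_scaleR[of "-1" x] by simp
    show "\<exists>c. T i x = x - c *\<^sub>R e i" for i x unfolding T_def by blast
  qed (use L lnorm_triangle T_projects in auto)
  then show ?thesis ..
qed

definition linear_on_V :: "(('b \<Rightarrow> real) \<Rightarrow> real) \<Rightarrow> bool"
  where "linear_on_V F \<longleftrightarrow> (\<forall>u\<in>V. \<forall>v\<in>V. F (u + v) = F u + F v) \<and>
    (\<forall>c. \<forall>u\<in>V. F (c *\<^sub>R u) = c * F u)"

lemma linear_on_VD:
  assumes "linear_on_V F"
  shows "u \<in> V \<Longrightarrow> v \<in> V \<Longrightarrow> F (u + v) = F u + F v"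
    and "u \<in> V \<Longrightarrow> F (c *\<^sub>R u) = c * F u"
    and "F 0 = 0"
proof -
  show "u \<in> V \<Longrightarrow> v \<in> V \<Longrightarrow> F (u + v) = F u + F v"
    and hom: "u \<in> V \<Longrightarrow> F (c *\<^sub>R u) = c * F u" for u v c
    using assms unfolding linear_on_V_def by blast+
  show "F 0 = 0" using hom[OF span_zero, of 0] by simp
qed

text \<open>Induction along the chain: the last coordinate is split off, and
  \<open>nrm_last_coordinate_le\<close> bounds both it and the remainder by multiples of
  \<open>lnorm y\<close>. The constant does not depend on \<open>F\<close>.\<close>

lemma functional_bound:
  assumes "k \<le> Suc m"
  shows "\<exists>C>0. \<forall>F s y. linear_on_V F
    \<longrightarrow> (\<forall>i<k. \<bar>F (e i)\<bar> \<le> s) \<longrightarrow> 0 \<le> s \<longrightarrow> y \<in> span (e ` {..<k}) \<longrightarrow> \<bar>F y\<bar> \<le> C * s * lnorm y"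
  using assms
proof (induction k)
  case 0
  show ?case
  proof (intro exI[of _ 1] conjI allI impI)
    fix F :: "('b \<Rightarrow> real) \<Rightarrow> real" and s :: real and y :: "'b \<Rightarrow> real"
    assume "linear_on_V F" "0 \<le> s" "y \<in> span (e ` {..<0})"
    then show "\<bar>F y\<bar> \<le> 1 * s * lnorm y" using linear_on_VD(3)[of F] by simp
  qed simp
next
  case (Suc k)
  obtain L where "coordinate_steps lnorm e T L (Suc m)" using steps_ex by blast
  then interpret coordinate_steps lnorm e T L "Suc m" .
  obtain C where C: "0 < C" and bound: "\<And>F s y. linear_on_V F \<Longrightarrow> (\<forall>i<k. \<bar>F (e i)\<bar> \<le> s) \<Longrightarrow> 0 \<le> s \<Longrightarrow>
      y \<in> span (e ` {..<k}) \<Longrightarrow> \<bar>F y\<bar> \<le> C * s * lnorm y"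
    using Suc.IH Suc_leD[OF Suc.prems] by blast
  have k: "k \<le> m" "k < Suc m" using Suc.prems by auto
  define D where "D = C * (2 + L) + (1 + L) / lnorm (e k)"
  have "\<bar>F y\<bar> \<le> D * s * lnorm y"
    if lin: "linear_on_V F" and s: "\<forall>i<Suc k. \<bar>F (e i)\<bar> \<le> s" "0 \<le> s" and y: "y \<in> X (Suc k)" for F s y
  proof -
    obtain a where a: "y - a *\<^sub>R e k \<in> X k" using y X_Suc by blast
    define z where "z = y - a *\<^sub>R e k"
    have ak: "lnorm (a *\<^sub>R e k) \<le> (1 + L) * lnorm y"
      using nrm_last_coordinate_le[OF a k(2)] .
    then have z: "lnorm z \<le> (2 + L) * lnorm y"
      using nrm_diff[of y "a *\<^sub>R e k"] by (simp add: z_def algebra_simps)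
    have abs_a: "\<bar>a\<bar> \<le> (1 + L) / lnorm (e k) * lnorm y"
      using ak lnorm_e_pos[OF k(1)] by (simp add: lnorm_scaleR field_simps)
    have zV: "z \<in> V"
      using a X_mono[of k "Suc m"] k by (auto simp: z_def V_eq)
    have "F y = F (z + a *\<^sub>R e k)" by (simp add: z_def)
    also have "\<dots> = F z + a * F (e k)"
      using linear_on_VD[OF lin] zV e_in_V[OF k(1)] by (simp add: span_scale)
    finally have "\<bar>F y\<bar> \<le> \<bar>F z\<bar> + \<bar>a\<bar> * \<bar>F (e k)\<bar>" by (metis abs_mult abs_triangle_ineq)
    also have "\<bar>F z\<bar> \<le> C * s * lnorm z"
      using bound[OF lin _ s(2)] s(1) a by (simp add: z_def)
    also have "\<dots> \<le> C * s * ((2 + L) * lnorm y)"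
      using z C s(2) by (intro mult_left_mono) auto
    also have "\<bar>a\<bar> * \<bar>F (e k)\<bar> \<le> ((1 + L) / lnorm (e k) * lnorm y) * s"
      using abs_a s L_ge_1 by (intro mult_mono) auto
    finally show ?thesis by (simp add: D_def algebra_simps)
  qed
  moreover have "0 < D" using C L_ge_1 by (auto simp: D_def intro!: add_pos_nonneg mult_pos_pos)
  ultimately show ?case by (intro exI[of _ D]) blast
qed

text \<open>The dictionary spans \<open>V\<close>, so a functional that is small on all of it would
  be small at \<open>u\<close>, against \<open>F u = 1\<close>.\<close>

lemma functional_large_on_dict:
  "\<exists>c>0. \<forall>F u i. linear_on_V F
    \<longrightarrow> u \<in> V \<longrightarrow> lnorm u = 1 \<longrightarrow> F u = 1 \<longrightarrow> (\<forall>j\<le>m. \<bar>F (e j)\<bar> \<le> \<bar>F (e i)\<bar>) \<longrightarrow> c \<le> \<bar>F (e i)\<bar>"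
proof -
  obtain C where C: "0 < C" "\<And>F s y. linear_on_V F \<Longrightarrow> (\<forall>i<Suc m. \<bar>F (e i)\<bar> \<le> s) \<Longrightarrow> 0 \<le> s \<Longrightarrow>
      y \<in> V \<Longrightarrow> \<bar>F y\<bar> \<le> C * s * lnorm y"
    using functional_bound[of "Suc m"] unfolding V_eq[symmetric] by blast
  have "1 / C \<le> \<bar>F (e i)\<bar>"
    if "linear_on_V F" "u \<in> V" "lnorm u = 1" "F u = 1" "\<forall>j\<le>m. \<bar>F (e j)\<bar> \<le> \<bar>F (e i)\<bar>" for F u i
  proof -
    have "\<bar>F u\<bar> \<le> C * \<bar>F (e i)\<bar> * lnorm u"
      by (rule C(2)) (use that in auto)
    then show ?thesis using that C(1) by (simp add: field_simps)
  qed
  then show ?thesis using C(1) by (intro exI[of _ "1 / C"]) auto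
qed

text \<open>By uniform smoothness, a lower bound that is linear in \<open>t\<close> on one side of \<open>u\<close> forces the
  norm down on the other side.\<close>

lemma uniform_decrease:
  assumes "0 < c"
  shows "\<exists>\<theta>. 0 < \<theta> \<and> \<theta> < 1 \<and> (\<forall>i\<le>m. \<forall>u b. lnorm u = 1 \<longrightarrow> c \<le> \<bar>b\<bar> \<longrightarrow>
    (\<forall>t. 0 \<le> t * b \<longrightarrow> 1 + t * b \<le> lnorm (u + t *\<^sub>R e i) powr p) \<longrightarrow>
    (\<exists>t. lnorm (u - t *\<^sub>R e i) \<le> \<theta>))"
proof -
  obtain R where R: "0 < R" "\<And>y t. t \<in> A \<Longrightarrow> \<bar>y t\<bar> \<le> R * lnorm y" using abs_le_lnorm by blast
  obtain K where K: "1 \<le> K" "\<And>i t. i \<le> m \<Longrightarrow> t \<in> A \<Longrightarrow> \<bar>e i t\<bar> \<le> K" using e_upper by blast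
  \<comment> \<open>\<open>r * (\<epsilon> * S)\<close> will bound the second-difference error
    summed over \<open>A\<close>; \<epsilon> makes it at most half of the linear gain
    \<open>r * c\<close>.\<close>
  define S where "S = w * real (card A) * K"
  have S: "0 \<le> S" using w_pos K by (simp add: S_def)
  define \<epsilon> where "\<epsilon> = c / (2 * (S + 1))"
  have \<epsilon>: "0 < \<epsilon>" "\<epsilon> * S \<le> c / 2"
    using assms S by (auto simp: \<epsilon>_def field_simps)
  obtain \<tau> where \<tau>: "0 < \<tau>" "\<And>v s. \<bar>v\<bar> \<le> R \<Longrightarrow> \<bar>s\<bar> \<le> \<tau> \<Longrightarrow>
      \<bar>v + s\<bar> powr p + \<bar>v - s\<bar> powr p \<le> 2 * \<bar>v\<bar> powr p + \<epsilon> * \<bar>s\<bar>"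
    using abs_powr_second_difference[OF p_gt_1 \<epsilon>(1)] by blast
  \<comment> \<open>\<open>r\<close> is the step length: \<open>r * K \<le> \<tau>\<close> admits
    the second-difference bound at every point, and \<open>r * c \<le> 1\<close> keeps the base of
    \<theta> positive.\<close>
  define r where "r = min (\<tau> / K) (1 / c)"
  have r: "0 < r" "r * K \<le> \<tau>" "r * c \<le> 1"
    using \<tau>(1) K(1) assms by (auto simp: r_def min_def field_simps)
  define \<theta> where "\<theta> = (1 - r * c / 2) powr (1 / p)"
  have rc: "0 < r * c" using r assms by simp
  have "0 < \<theta>" using r by (simp add: \<theta>_def)
  moreover have "\<theta> < 1"
    using rc r p_gt_1 powr_less_mono2[of "1 / p" "1 - r * c / 2" 1] by (simp add: \<theta>_def)
  moreover have "\<exists>t. lnorm (u - t *\<^sub>R e i) \<le> \<theta>"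
    if i: "i \<le> m" and u: "lnorm u = 1" and b: "c \<le> \<bar>b\<bar>"
      and lower: "\<forall>t. 0 \<le> t * b \<longrightarrow> 1 + t * b \<le> lnorm (u + t *\<^sub>R e i) powr p" for i u b
  proof -
    \<comment> \<open>The sign of \<open>b\<close> puts \<open>u + t *\<^sub>R e i\<close> on the
      side of the lower bound, so the norm drops at \<open>u - t *\<^sub>R e i\<close>.\<close>
    define t where "t = r * sgn b"
    have "b \<noteq> 0" using b assms by auto
    then have t: "\<bar>t\<bar> = r" "t * b = r * \<bar>b\<bar>"
      using r by (auto simp: t_def abs_mult abs_sgn_eq mult_ac sgn_if)
    have pt: "\<bar>u x + t * e i x\<bar> powr p + \<bar>u x - t * e i x\<bar> powr p \<le> 2 * \<bar>u x\<bar> powr p + \<epsilon> * (r * K)"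
      if "x \<in> A" for x
    proof -
      have tx: "\<bar>t * e i x\<bar> \<le> r * K"
        using t K(2)[OF i that] r by (simp add: abs_mult)
      then have "\<bar>u x + t * e i x\<bar> powr p + \<bar>u x - t * e i x\<bar> powr p
          \<le> 2 * \<bar>u x\<bar> powr p + \<epsilon> * \<bar>t * e i x\<bar>"
        using R(2)[OF that, of u] u r by (intro \<tau>(2)) auto
      also have "\<epsilon> * \<bar>t * e i x\<bar> \<le> \<epsilon> * (r * K)"
        using tx \<epsilon> by (intro mult_left_mono) auto
      finally show ?thesis by simp
    qed
    have "lnorm (u + t *\<^sub>R e i) powr p + lnorm (u - t *\<^sub>R e i) powr p
        = w * (\<Sum>x\<in>A. \<bar>u x + t * e i x\<bar> powr p + \<bar>u x - t * e i x\<bar> powr p)"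
      by (simp add: lnorm_powr sum.distrib distrib_left)
    also have "\<dots> \<le> w * (\<Sum>x\<in>A. 2 * \<bar>u x\<bar> powr p + \<epsilon> * (r * K))"
      using w_pos pt by (intro mult_left_mono sum_mono) auto
    also have "\<dots> = 2 * (w * (\<Sum>x\<in>A. \<bar>u x\<bar> powr p)) + r * (\<epsilon> * S)"
      by (simp add: S_def sum.distrib sum_distrib_left distrib_left mult_ac)
    also have "\<dots> = 2 + r * (\<epsilon> * S)"
      using lnorm_powr[of u] u by simp
    also have "\<dots> \<le> 2 + r * (c / 2)"
      using \<epsilon> r by (intro add_left_mono mult_left_mono) auto
    finally have "lnorm (u - t *\<^sub>R e i) powr p \<le> 2 + r * (c / 2) - lnorm (u + t *\<^sub>R e i) powr p"
      by simp
    also have "\<dots> \<le> 2 + r * (c / 2) - (1 + r * \<bar>b\<bar>)"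
      using lower[rule_format, of t] t r by simp
    also have "\<dots> \<le> 2 + r * (c / 2) - (1 + r * c)"
      using mult_left_mono[OF b less_imp_le[OF r(1)]] by linarith
    also have "\<dots> = \<theta> powr p"
      using r p_gt_1 by (simp add: \<theta>_def powr_powr)
    finally have "lnorm (u - t *\<^sub>R e i) \<le> \<theta>"
      using \<open>0 < \<theta>\<close> lnorm_le_iff[of \<theta>] by simp
    then show ?thesis by blast
  qed
  ultimately show ?thesis by blast
qed

section \<open>Geometric decrease for both selection rules\<close>

lemma decrease_scale:
  assumes "0 < lnorm y" "lnorm ((1 / lnorm y) *\<^sub>R y - t *\<^sub>R e i) \<le> \<theta>"
  shows "\<exists>l. lnorm (y - l *\<^sub>R e i) \<le> \<theta> * lnorm y"
proof -
  have "lnorm (y - (lnorm y * t) *\<^sub>R e i) = lnorm (lnorm y *\<^sub>R ((1 / lnorm y) *\<^sub>R y - t *\<^sub>R e i))"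
    using assms(1) by (simp add: scaleR_diff_right)
  also have "\<dots> = lnorm y * lnorm ((1 / lnorm y) *\<^sub>R y - t *\<^sub>R e i)"
    by (simp add: lnorm_scaleR del: scaleR_scaleR)
  also have "\<dots> \<le> lnorm y * \<theta>" using assms by (intro mult_left_mono) auto
  finally show ?thesis by (auto simp: mult.commute)
qed

text \<open>A suitable functional at the normalized vector \<open>u\<close> is large on some
  dictionary element. Convexity turns this into a linear lower bound for the \<open>p\<close>-th
  power of the norm, to which \<open>uniform_decrease\<close> applies.\<close>

lemma best_decrease:
  "\<exists>\<theta>. 0 < \<theta> \<and> \<theta> < 1 \<and> (\<forall>y\<in>V. 0 < lnorm y \<longrightarrow> (\<exists>i\<le>m. \<exists>l. lnorm (y - l *\<^sub>R e i) \<le> \<theta> * lnorm y))"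
proof -
  obtain c where c: "0 < c" and large: "\<And>F u i. linear_on_V F \<Longrightarrow> u \<in> V \<Longrightarrow> lnorm u = 1 \<Longrightarrow> F u = 1 \<Longrightarrow>
      (\<forall>j\<le>m. \<bar>F (e j)\<bar> \<le> \<bar>F (e i)\<bar>) \<Longrightarrow> c \<le> \<bar>F (e i)\<bar>"
    using functional_large_on_dict by blast
  obtain \<theta> where \<theta>: "0 < \<theta>" "\<theta> < 1" and dec: "\<And>i u b. i \<le> m \<Longrightarrow> lnorm u = 1 \<Longrightarrow> c \<le> \<bar>b\<bar> \<Longrightarrow>
      (\<forall>t. 0 \<le> t * b \<longrightarrow> 1 + t * b \<le> lnorm (u + t *\<^sub>R e i) powr p) \<Longrightarrow>
      \<exists>t. lnorm (u - t *\<^sub>R e i) \<le> \<theta>"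
    using uniform_decrease[OF c] by blast
  have "\<exists>i\<le>m. \<exists>l. lnorm (y - l *\<^sub>R e i) \<le> \<theta> * lnorm y" if y: "y \<in> V" "0 < lnorm y" for y
  proof -
    define u where "u = (1 / lnorm y) *\<^sub>R y"
    have u: "u \<in> V" "lnorm u = 1" using y by (auto simp: u_def lnorm_scaleR span_scale)
    \<comment> \<open>The norming functional of the unit vector \<open>u\<close>:
      \<open>1 / p\<close> times the derivative of the \<open>p\<close>-th power of
      \<open>lnorm\<close> at \<open>u\<close>.\<close>
    define F where "F v = w * (\<Sum>t\<in>A. spow (p - 1) (u t) * v t)" for v
    have "F u = lnorm u powr p" by (simp add: F_def lnorm_powr spow_mult_self)
    then have Fu: "F u = 1" using u by simp
    let ?S = "(\<lambda>j. \<bar>F (e j)\<bar>) ` {..m}"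
    have "Max ?S \<in> ?S" by (rule Max_in) auto
    then obtain i where "i \<le> m" "Max ?S = \<bar>F (e i)\<bar>" unfolding image_iff by blast
    moreover have "\<bar>F (e j)\<bar> \<le> Max ?S" if "j \<le> m" for j using that by (intro Max_ge) auto
    ultimately have i: "i \<le> m" "\<forall>j\<le>m. \<bar>F (e j)\<bar> \<le> \<bar>F (e i)\<bar>" by auto
    have large_i: "c \<le> \<bar>F (e i)\<bar>"
      by (rule large[OF _ u Fu i(2)])
        (simp add: linear_on_V_def F_def sum.distrib distrib_left distrib_right sum_distrib_left mult_ac)
    have "c \<le> \<bar>p * F (e i)\<bar>"
    proof -
      have "1 * \<bar>F (e i)\<bar> \<le> p * \<bar>F (e i)\<bar>" using p_gt_1 by (intro mult_right_mono) auto
      then show ?thesis using large_i p_gt_1 by (simp add: abs_mult)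
    qed
    moreover have "1 + t * (p * F (e i)) \<le> lnorm (u + t *\<^sub>R e i) powr p" for t
    proof -
      have "1 + t * (p * F (e i)) = lnorm u powr p + t * (p * F (e i))" using u by simp
      also have "\<dots> = w * (\<Sum>x\<in>A. \<bar>u x\<bar> powr p + p * spow (p - 1) (u x) * ((u x + t * e i x) - u x))"
        by (simp add: lnorm_powr F_def sum.distrib distrib_left sum_distrib_left mult_ac)
      also have "\<dots> \<le> w * (\<Sum>x\<in>A. \<bar>u x + t * e i x\<bar> powr p)"
        using w_pos by (intro mult_left_mono sum_mono abs_powr_tangent p_gt_1) auto
      finally show ?thesis by (simp add: lnorm_powr)
    qed
    ultimately obtain t where "lnorm (u - t *\<^sub>R e i) \<le> \<theta>" using dec[OF i(1) u(2)] by blast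
    then show ?thesis using decrease_scale[OF y(2)] i(1) unfolding u_def by blast
  qed
  then show ?thesis using \<theta> by blast
qed

text \<open>Since \<open>F\<close> is dominated by the norm and attains it at \<open>y\<close>, the
  norm of \<open>u + t *\<^sub>R e i\<close> is at least \<open>1 + t * F (e i)\<close>, and this
  feeds \<open>uniform_decrease\<close>.\<close>

lemma dual_decrease:
  "\<exists>\<theta>. 0 < \<theta> \<and> \<theta> < 1 \<and> (\<forall>y\<in>V. \<forall>F i. 0 < lnorm y \<longrightarrow>
    linear_on_V F \<longrightarrow>
    (\<forall>u\<in>V. F u \<le> lnorm u) \<longrightarrow> F y = lnorm y \<longrightarrow> i \<le> m \<longrightarrow> (\<forall>j\<le>m. \<bar>F (e j)\<bar> \<le> \<bar>F (e i)\<bar>) \<longrightarrow>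
    (\<exists>l. lnorm (y - l *\<^sub>R e i) \<le> \<theta> * lnorm y))"
proof -
  obtain c where c: "0 < c" and large: "\<And>F u i. linear_on_V F \<Longrightarrow> u \<in> V \<Longrightarrow> lnorm u = 1 \<Longrightarrow> F u = 1 \<Longrightarrow>
      (\<forall>j\<le>m. \<bar>F (e j)\<bar> \<le> \<bar>F (e i)\<bar>) \<Longrightarrow> c \<le> \<bar>F (e i)\<bar>"
    using functional_large_on_dict by blast
  obtain \<theta> where \<theta>: "0 < \<theta>" "\<theta> < 1" and dec: "\<And>i u b. i \<le> m \<Longrightarrow> lnorm u = 1 \<Longrightarrow> c \<le> \<bar>b\<bar> \<Longrightarrow>
      (\<forall>t. 0 \<le> t * b \<longrightarrow> 1 + t * b \<le> lnorm (u + t *\<^sub>R e i) powr p) \<Longrightarrow>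
      \<exists>t. lnorm (u - t *\<^sub>R e i) \<le> \<theta>"
    using uniform_decrease[OF c] by blast
  have "\<exists>l. lnorm (y - l *\<^sub>R e i) \<le> \<theta> * lnorm y"
    if y: "y \<in> V" "0 < lnorm y" and lin: "linear_on_V F" and le: "\<forall>u\<in>V. F u \<le> lnorm u"
      and Fy: "F y = lnorm y" and i: "i \<le> m" "\<forall>j\<le>m. \<bar>F (e j)\<bar> \<le> \<bar>F (e i)\<bar>" for y F i
  proof -
    define u where "u = (1 / lnorm y) *\<^sub>R y"
    have u: "u \<in> V" "lnorm u = 1" using y by (auto simp: u_def lnorm_scaleR span_scale)
    have Fu: "F u = 1" using y Fy linear_on_VD(2)[OF lin] by (simp add: u_def)
    have "c \<le> \<bar>F (e i)\<bar>" by (rule large[OF lin u Fu i(2)])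
    moreover have "1 + t * F (e i) \<le> lnorm (u + t *\<^sub>R e i) powr p" if "0 \<le> t * F (e i)" for t
    proof -
      have V: "e i \<in> V" "t *\<^sub>R e i \<in> V" using e_in_V[OF i(1)] by (auto intro: span_scale)
      then have "1 + t * F (e i) = F (u + t *\<^sub>R e i)"
        using linear_on_VD[OF lin] Fu u by simp
      also have "\<dots> \<le> lnorm (u + t *\<^sub>R e i)"
        using le span_add[OF u(1) V(2)] by blast
      finally have 1: "1 + t * F (e i) \<le> lnorm (u + t *\<^sub>R e i)" .
      \<comment> \<open>Raising the exponent to \<open>p\<close> requires a norm of at least 1;
        hence the restriction to \<open>0 \<le> t * b\<close> in
        \<open>uniform_decrease\<close>.\<close>
      then have "lnorm (u + t *\<^sub>R e i) powr 1 \<le> lnorm (u + t *\<^sub>R e i) powr p"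
        using that p_gt_1 by (intro powr_mono) auto
      then show ?thesis using 1 by simp
    qed
    ultimately obtain t where "lnorm (u - t *\<^sub>R e i) \<le> \<theta>" using dec[OF i(1) u(2)] by blast
    then show ?thesis using decrease_scale[OF y(2)] unfolding u_def by blast
  qed
  then show ?thesis using \<theta> by (intro exI[of _ \<theta>]) blast
qed

end

text \<open>\<open>nrm\<close> is the actual norm, tied to \<open>lnorm\<close> on the span only.
  Termination asks for the zero function, also off \<open>A\<close>; this is the purpose of
  \<open>definite\<close>.\<close>

locale lp_chain_space = lp_chain A w p e m
  for A :: "'b set" and w p e m +
  fixes nrm :: "('b \<Rightarrow> real) \<Rightarrow> real"
  assumes nrm_eq: "y \<in> span (e ` {0..m}) \<Longrightarrow> nrm y = lnorm y"
    and definite: "y \<in> span (e ` {0..m}) \<Longrightarrow> (\<And>t. t \<in> A \<Longrightarrow> y t = 0) \<Longrightarrow> y = 0"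
begin

section \<open>Termination of both greedy algorithms\<close>

abbreviation D :: "('b \<Rightarrow> real) set"
  where "D \<equiv> e ` {0..m}"

lemma lnorm_pos: "y \<in> V \<Longrightarrow> y \<noteq> 0 \<Longrightarrow> 0 < lnorm y"
  using definite[of y] lnorm_eq_0_iff[of y] lnorm_nonneg[of y] unfolding less_le by metis

lemma diff_in_V: "y \<in> V \<Longrightarrow> i \<le> m \<Longrightarrow> y - l *\<^sub>R e i \<in> V"
  by (rule span_diff[OF _ span_scale[OF e_in_V]])

lemma greedy_step_T:
  assumes "greedy_step nrm select y z" "y \<in> V" "\<And>\<phi>. select y \<phi> \<Longrightarrow> \<phi> \<in> D"
  shows "\<exists>i\<le>m. select y (e i) \<and> z = T i y \<and> (\<forall>l. lnorm z \<le> lnorm (y - l *\<^sub>R e i))"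
proof -
  obtain \<phi> l where sel: "select y \<phi>" and min: "\<And>k. nrm (y - l *\<^sub>R \<phi>) \<le> nrm (y - k *\<^sub>R \<phi>)"
    and z: "z = y - l *\<^sub>R \<phi>" using assms(1) unfolding greedy_step_def by blast
  obtain i where i: "i \<le> m" "\<phi> = e i" using assms(3)[OF sel] unfolding image_iff by auto
  have "lnorm (y - l *\<^sub>R e i) \<le> lnorm (y - k *\<^sub>R e i)" for k
    using min[of k] nrm_eq diff_in_V[OF assms(2) i(1)] i(2) by simp
  then have "z = T i y" "\<forall>k. lnorm z \<le> lnorm (y - k *\<^sub>R e i)"
    using minimizer_T[OF i(1)] i(2) z by auto
  then show ?thesis using sel i by blast
qed

text \<open>A greedy step minimizes over the whole line, so one good coefficient \<open>l\<close> in
  \<open>red\<close> makes the step itself reduce the norm. A greedy run without a zero up to index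
  \<open>n\<close> is then a reducing run of the excluded length.\<close>

lemma terminates_if_reducing:
  assumes \<theta>: "0 < \<theta>" "\<theta> < 1" and sel: "\<And>y \<phi>. select y \<phi> \<Longrightarrow> \<phi> \<in> D"
    and red: "\<And>y i. y \<in> V \<Longrightarrow> y \<noteq> 0 \<Longrightarrow> i \<le> m \<Longrightarrow> select y (e i) \<Longrightarrow> \<exists>l. lnorm (y - l *\<^sub>R e i) \<le> \<theta> * lnorm y"
  shows "\<exists>N. \<forall>x\<in>V. terminates_within nrm select N x"
proof -
  obtain L where "coordinate_steps lnorm e T L (Suc m)" using steps_ex by blast
  then interpret coordinate_steps lnorm e T L "Suc m" .
  obtain n where n: "\<And>y. \<not> reducing_run (Suc m) \<theta> n y" using reducing_runs_bounded[OF _ \<theta>] by blast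
  have "terminates_within nrm select n x" if "x \<in> V" for x
    unfolding terminates_within_def
  proof (intro allI impI, rule ccontr)
    fix y
    assume run: "greedy_run nrm select x y" and "\<not> (\<exists>k\<le>n. y k = 0)"
    then have nz: "y j \<noteq> 0" if "j \<le> n" for j using that by blast
    have step: "greedy_step nrm select (y j) (y (Suc j))" if "j \<le> n" for j
      using run nz that unfolding greedy_run_def by auto
    have yV: "y j \<in> V" if "j \<le> n" for j
      using that
    proof (induction j)
      case 0
      then show ?case using run \<open>x \<in> V\<close> by (simp add: greedy_run_def)
    next
      case (Suc j)
      then have j: "j \<le> n" "y j \<in> V" by auto
      then have "\<exists>i\<le>m. select (y j) (e i) \<and> y (Suc j) = T i (y j) \<and>
          (\<forall>l. lnorm (y (Suc j)) \<le> lnorm (y j - l *\<^sub>R e i))"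
        by (intro greedy_step_T[OF step] sel)
      then obtain i where "i \<le> m" "y (Suc j) = T i (y j)" by blast
      then show ?case using j(2) T_in_X[of "y j" "Suc m" i] unfolding V_eq by simp
    qed
    have "\<exists>i<Suc m. y (Suc j) = T i (y j) \<and> lnorm (y (Suc j)) \<le> \<theta> * lnorm (y j)" if "j < n" for j
    proof -
      have j: "j \<le> n" using that by simp
      have "\<exists>i\<le>m. select (y j) (e i) \<and> y (Suc j) = T i (y j) \<and>
          (\<forall>l. lnorm (y (Suc j)) \<le> lnorm (y j - l *\<^sub>R e i))"
        by (intro greedy_step_T[OF step[OF j] yV[OF j]] sel)
      then obtain i where i: "i \<le> m" "select (y j) (e i)" "y (Suc j) = T i (y j)"
        "\<And>l. lnorm (y (Suc j)) \<le> lnorm (y j - l *\<^sub>R e i)" by blast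
      obtain l where "lnorm (y j - l *\<^sub>R e i) \<le> \<theta> * lnorm (y j)"
        using red[OF yV[OF j] nz[OF j] i(1,2)] by blast
      then have "lnorm (y (Suc j)) \<le> \<theta> * lnorm (y j)" using i(4)[of l] by linarith
      then show ?thesis using i by (intro exI[of _ i]) simp
    qed
    moreover have "0 < lnorm (y j)" if "j \<le> n" for j using that yV nz lnorm_pos by blast
    moreover have "y 0 \<in> X (Suc m)" using yV[of 0] unfolding V_eq by simp
    ultimately have "reducing_run (Suc m) \<theta> n y" unfolding reducing_run_def by blast
    then show False using n by blast
  qed
  then show ?thesis by blast
qed

lemma xga_terminates: "\<exists>N. \<forall>x\<in>V. terminates_within nrm (xga_select nrm D) N x"
proof -
  obtain \<theta> where \<theta>: "0 < \<theta>" "\<theta> < 1" and best: "\<And>y. y \<in> V \<Longrightarrow> 0 < lnorm y \<Longrightarrow>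
      \<exists>i\<le>m. \<exists>l. lnorm (y - l *\<^sub>R e i) \<le> \<theta> * lnorm y"
    using best_decrease by blast
  show ?thesis
  proof (rule terminates_if_reducing[OF \<theta>])
    fix y i
    assume y: "y \<in> V" "y \<noteq> 0" and i: "i \<le> m" "xga_select nrm D y (e i)"
    obtain j k where j: "j \<le> m" "lnorm (y - k *\<^sub>R e j) \<le> \<theta> * lnorm y"
      using best[OF y(1) lnorm_pos[OF y]] by blast
    \<comment> \<open>This \<open>l\<close> attains the double minimum in \<open>xga_select\<close>,
      so it competes with the pair from \<open>best_decrease\<close>.\<close>
    obtain l where "nrm (y - l *\<^sub>R e i) \<le> nrm (y - k *\<^sub>R e j)"
      using i(2) j(1) unfolding xga_select_def by fastforce
    then have "lnorm (y - l *\<^sub>R e i) \<le> lnorm (y - k *\<^sub>R e j)"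
      using nrm_eq diff_in_V[OF y(1)] i(1) j(1) by simp
    then have "lnorm (y - l *\<^sub>R e i) \<le> \<theta> * lnorm y" using j(2) by linarith
    then show "\<exists>l. lnorm (y - l *\<^sub>R e i) \<le> \<theta> * lnorm y" ..
  qed (simp add: xga_select_def)
qed

text \<open>Scaling \<open>u\<close> to norm 1 gives a vector that enters the supremum in
  \<open>dual_norm\<close>, which equals 1.\<close>

lemma norming_functional_le:
  assumes F: "norming_functional nrm V y F" and u: "u \<in> V"
  shows "F u \<le> lnorm u"
proof (cases "u = 0")
  case True
  have "linear_on_V F"
    using F unfolding norming_functional_def dual_elem_def linear_on_V_def by blast
  then show ?thesis using linear_on_VD(3)[of F] True by simp
next
  case False
  have pos: "0 < lnorm u" using lnorm_pos[OF u False] .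
  define v where "v = (1 / lnorm u) *\<^sub>R u"
  have v: "v \<in> V" "nrm v = 1" using u pos by (auto simp: v_def span_scale nrm_eq lnorm_scaleR)
  have hom: "F (c *\<^sub>R u) = c * F u" for c
    using F u unfolding norming_functional_def dual_elem_def by blast
  obtain C where C: "\<And>x. x \<in> V \<Longrightarrow> \<bar>F x\<bar> \<le> C * nrm x"
    using F unfolding norming_functional_def dual_elem_def by blast
  \<comment> \<open>A real supremum bounds its members only if the set is bounded, which
    \<open>dual_elem\<close> supplies. The absolute value covers a negative
    \<open>C\<close>.\<close>
  have bdd: "bdd_above ((\<lambda>x. \<bar>F x\<bar>) ` {x \<in> V. nrm x \<le> 1})"
  proof (intro bdd_aboveI2[where M = "\<bar>C\<bar>"])
    fix x
    assume x: "x \<in> {x \<in> V. nrm x \<le> 1}"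
    then have "\<bar>F x\<bar> \<le> C * nrm x" "0 \<le> nrm x" using C[of x] nrm_eq[of x] by auto
    note this(1)
    also have "C * nrm x \<le> \<bar>C\<bar> * nrm x" using \<open>0 \<le> nrm x\<close> by (intro mult_right_mono) auto
    also have "\<dots> \<le> \<bar>C\<bar> * 1" using x by (intro mult_left_mono) auto
    finally show "\<bar>F x\<bar> \<le> \<bar>C\<bar>" by simp
  qed
  have "\<bar>F v\<bar> \<le> dual_norm nrm V F"
    unfolding dual_norm_def using v by (intro cSUP_upper[OF _ bdd]) auto
  then have "F v \<le> 1" using F unfolding norming_functional_def by simp
  then show ?thesis using pos hom[of "1 / lnorm u"] by (simp add: v_def field_simps)
qed

lemma dga_terminates: "\<exists>N. \<forall>x\<in>V. terminates_within nrm (dga_select nrm V D) N x"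
proof -
  obtain \<theta> where \<theta>: "0 < \<theta>" "\<theta> < 1" and dual: "\<And>y F i. y \<in> V \<Longrightarrow> 0 < lnorm y \<Longrightarrow>
      linear_on_V F \<Longrightarrow>
      (\<forall>u\<in>V. F u \<le> lnorm u) \<Longrightarrow> F y = lnorm y \<Longrightarrow> i \<le> m \<Longrightarrow> (\<forall>j\<le>m. \<bar>F (e j)\<bar> \<le> \<bar>F (e i)\<bar>) \<Longrightarrow>
      \<exists>l. lnorm (y - l *\<^sub>R e i) \<le> \<theta> * lnorm y"
    using dual_decrease by blast
  show ?thesis
  proof (rule terminates_if_reducing[OF \<theta>])
    fix y i
    assume y: "y \<in> V" "y \<noteq> 0" and i: "i \<le> m" "dga_select nrm V D y (e i)"
    obtain F where F: "norming_functional nrm V y F" and max: "\<forall>\<psi>\<in>D. \<bar>F \<psi>\<bar> \<le> \<bar>F (e i)\<bar>"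
      using i(2) unfolding dga_select_def by blast
    show "\<exists>l. lnorm (y - l *\<^sub>R e i) \<le> \<theta> * lnorm y"
    proof (rule dual[OF y(1) lnorm_pos[OF y]])
      show "linear_on_V F"
        using F unfolding norming_functional_def dual_elem_def linear_on_V_def by blast
      show "\<forall>u\<in>V. F u \<le> lnorm u" using norming_functional_le[OF F] by blast
      show "F y = lnorm y" using F nrm_eq[OF y(1)] unfolding norming_functional_def by simp
      show "\<forall>j\<le>m. \<bar>F (e j)\<bar> \<le> \<bar>F (e i)\<bar>" using max by auto
    qed (rule i(1))
  qed (simp add: dga_select_def)
qed

theorem greedy_algorithms_terminate:
  "\<exists>N>0. \<forall>x\<in>V. terminates_within nrm (xga_select nrm D) N x \<and>
    terminates_within nrm (dga_select nrm V D) N x"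
proof -
  have mono: "terminates_within nrm select N' x" if "terminates_within nrm select N x" "N \<le> N'"
    for select N N' x
    using that unfolding terminates_within_def by (meson order_trans)
  obtain N1 where "\<forall>x\<in>V. terminates_within nrm (xga_select nrm D) N1 x"
    using xga_terminates by blast
  moreover obtain N2 where "\<forall>x\<in>V. terminates_within nrm (dga_select nrm V D) N2 x"
    using dga_terminates by blast
  ultimately show ?thesis
    by (intro exI[of _ "Suc (N1 + N2)"]) (auto elim!: mono)
qed

end

section \<open>The Haar system on dyadic cells\<close>

abbreviation dpt :: "nat \<Rightarrow> nat \<Rightarrow> real"
  where "dpt L q \<equiv> real q / 2 ^ L"

abbreviation cell :: "nat \<Rightarrow> nat \<Rightarrow> real set"
  where "cell L q \<equiv> {dpt L q ..< dpt L (Suc q)}"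

text \<open>\<open>haar_val L i q\<close> is the value of the \<open>i\<close>-th Haar function on the \<open>q\<close>-th cell of level \<open>L\<close>,
  provided \<open>i < 2 ^ L\<close>.\<close>

definition haar_val :: "nat \<Rightarrow> nat \<Rightarrow> nat \<Rightarrow> real"
  where "haar_val L i q = (if i = 0 then 1 else
    let c = q div 2 ^ (L - Suc (floor_log i)); k = i - 2 ^ floor_log i in
      of_bool (c = 2 * k) - of_bool (c = 2 * k + 1))"

lemma dpt_cell: "dpt L q \<in> cell L q"
  by (simp add: divide_strict_right_mono)

lemma cell_bounds:
  assumes "t \<in> cell L q" "q < 2 ^ L"
  shows "0 \<le> t" "t < 1"
proof -
  have "real (Suc q) \<le> real (2 ^ L)" unfolding of_nat_le_iff using assms(2) by simp
  then have "dpt L (Suc q) \<le> 1" by (simp add: divide_le_eq_1)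
  moreover have "0 \<le> dpt L q" by simp
  ultimately show "0 \<le> t" "t < 1" using assms(1) unfolding atLeastLessThan_iff by linarith+
qed

text \<open>The point \<open>a / 2 ^ n\<close> is itself a grid point of level \<open>L\<close>, and
  no grid point lies strictly inside a cell, so an integer comparison remains.\<close>

lemma dpt_le_iff:
  assumes "t \<in> cell L q" "n \<le> L"
  shows "real a / 2 ^ n \<le> t \<longleftrightarrow> a \<le> q div 2 ^ (L - n)"
proof -
  have "(2 :: real) ^ L = 2 ^ n * 2 ^ (L - n)"
    using assms(2) by (simp add: power_add[symmetric])
  then have a: "real a / 2 ^ n = dpt L (a * 2 ^ (L - n))" by simp
  have "dpt L (a * 2 ^ (L - n)) \<le> t \<longleftrightarrow> a * 2 ^ (L - n) \<le> q"
  proof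
    assume "a * 2 ^ (L - n) \<le> q"
    then have "dpt L (a * 2 ^ (L - n)) \<le> dpt L q"
      by (intro divide_right_mono) (simp_all only: of_nat_le_iff, simp)
    then show "dpt L (a * 2 ^ (L - n)) \<le> t" using assms(1) by simp
  next
    assume le: "dpt L (a * 2 ^ (L - n)) \<le> t"
    show "a * 2 ^ (L - n) \<le> q"
    proof (rule ccontr)
      assume "\<not> a * 2 ^ (L - n) \<le> q"
      then have "Suc q \<le> a * 2 ^ (L - n)" by simp
      then have "dpt L (Suc q) \<le> dpt L (a * 2 ^ (L - n))"
        by (intro divide_right_mono) (simp_all only: of_nat_le_iff, simp)
      then show False using le assms(1) by simp
    qed
  qed
  then show ?thesis unfolding a by (simp add: less_eq_div_iff_mult_less_eq)
qed

lemma floor_log_less: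
  assumes "0 < i" "i < 2 ^ L"
  shows "floor_log i < L"
proof -
  have "(2 :: nat) ^ floor_log i < 2 ^ L"
    using floor_log_exp2_le[OF assms(1)] assms(2) by linarith
  then show ?thesis by simp
qed

lemma haar_index_less: "i - 2 ^ floor_log i < 2 ^ floor_log i"
  using floor_log_exp2_gt[of i] by auto

lemma haar_cell:
  assumes "i < 2 ^ L" "q < 2 ^ L" "t \<in> cell L q"
  shows "haar i t = haar_val L i q"
proof (cases "i = 0")
  case True
  have "t \<in> {0..1}" using cell_bounds[OF assms(3,2)] by simp
  then show ?thesis using True by (simp add: haar_def haar_val_def)
next
  case False
  define n where "n = floor_log i"
  define k where "k = i - 2 ^ n"
  \<comment> \<open>\<open>c\<close> is the index of the cell of level \<open>Suc n\<close>
    containing \<open>t\<close>; the two halves of the support of \<open>haar i\<close> are the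
    cells \<open>2 * k\<close> and \<open>2 * k + 1\<close> of that level.\<close>
  define c where "c = q div 2 ^ (L - Suc n)"
  have n: "Suc n \<le> L" using floor_log_less[of i L] False assms(1) by (simp add: n_def)
  have iff: "real a / 2 ^ Suc n \<le> t \<longleftrightarrow> a \<le> c" for a
    using dpt_le_iff[OF assms(3) n] by (simp add: c_def)
  have ind: "indicator {real a / 2 ^ Suc n ..< real b / 2 ^ Suc n} t = (of_bool (a \<le> c \<and> c < b) :: real)"
    for a b
    using iff[of a] iff[of b] by (auto simp: indicator_def)
  have "haar i t = indicator {real (2 * k) / 2 ^ Suc n ..< real (2 * k + 1) / 2 ^ Suc n} t
      - indicator {real (2 * k + 1) / 2 ^ Suc n ..< real (2 * k + 2) / 2 ^ Suc n} t"
  proof -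
    have "real k / 2 ^ n = real (2 * k) / 2 ^ Suc n" by simp
    moreover have "(real k + 1) / 2 ^ n = real (2 * k + 2) / 2 ^ Suc n" by (simp add: field_simps)
    moreover have "(2 * real k + 1) / 2 ^ (n + 1) = real (2 * k + 1) / 2 ^ Suc n" by simp
    ultimately show ?thesis
      using False unfolding haar_def Let_def n_def[symmetric] k_def[symmetric]
      by (simp add: add.commute)
  qed
  also have "\<dots> = of_bool (2 * k \<le> c \<and> c < 2 * k + 1) - of_bool (2 * k + 1 \<le> c \<and> c < 2 * k + 2)"
    unfolding ind ..
  also have "\<dots> = of_bool (c = 2 * k) - of_bool (c = 2 * k + 1)"
    by (intro arg_cong2[where f = "(-)"] arg_cong[where f = of_bool]) auto
  also have "\<dots> = haar_val L i q"
    using False by (simp add: haar_val_def Let_def c_def k_def n_def)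
  finally show ?thesis .
qed

lemma haar_outside:
  assumes "t < 0 \<or> 1 < t \<or> (0 < i \<and> 1 \<le> t)"
  shows "haar i t = 0"
proof (cases "i = 0")
  case True
  then show ?thesis using assms by (auto simp: haar_def)
next
  case False
  define n where "n = floor_log i"
  define k where "k = i - 2 ^ n"
  have "real (Suc k) \<le> real (2 ^ n)"
    unfolding of_nat_le_iff using haar_index_less[of i] by (simp add: k_def n_def)
  then have hi: "(real k + 1) / 2 ^ n \<le> 1" by (simp add: field_simps)
  have mid: "(2 * real k + 1) / 2 ^ (n + 1) \<le> (real k + 1) / 2 ^ n"
    "real k / 2 ^ n \<le> (2 * real k + 1) / 2 ^ (n + 1)" "0 \<le> real k / 2 ^ n"
    by (simp_all add: field_simps)
  have "t < real k / 2 ^ n \<or> (real k + 1) / 2 ^ n \<le> t"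
    using assms hi mid by linarith
  then have "t \<notin> {real k / 2 ^ n ..< (2 * real k + 1) / 2 ^ (n + 1)}"
    "t \<notin> {(2 * real k + 1) / 2 ^ (n + 1) ..< (real k + 1) / 2 ^ n}"
    using mid by auto
  then show ?thesis
    using False unfolding haar_def Let_def n_def[symmetric] k_def[symmetric] by simp
qed

text \<open>Distinct functions of the same level have disjoint supports, so \<open>i\<close> gives
  the value 0. At a coarser level, the support of \<open>j\<close> lies in one dyadic interval of
  level \<open>floor_log j\<close>, and the value of \<open>i\<close> depends only on a cell at
  least as large.\<close>

lemma haar_val_const:
  assumes "i < j" "j < 2 ^ L" "haar_val L j q \<noteq> 0" "haar_val L j q' \<noteq> 0"
  shows "haar_val L i q = haar_val L i q'"
proof (cases "i = 0")
  case True
  then show ?thesis by (simp add: haar_val_def)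
next
  case False
  define n where "n = floor_log j"
  define k where "k = j - 2 ^ n"
  have n: "n < L" using floor_log_less[of j L] assms by (simp add: n_def)
  have half: "x div 2 ^ (L - Suc n) \<in> {2 * k, 2 * k + 1}" if "haar_val L j x \<noteq> 0" for x
    using that assms(1) by (auto simp: haar_val_def Let_def n_def k_def split: if_splits)
  have ni: "floor_log i \<le> n" using assms(1) by (simp add: n_def floor_log_le_iff)
  show ?thesis
  proof (cases "floor_log i = n")
    case True
    have "2 ^ n \<le> i" "2 ^ n \<le> j"
      using floor_log_exp2_le[of i] floor_log_exp2_le[of j] True False assms(1) by (auto simp: n_def)
    then have "i - 2 ^ n \<noteq> k" using assms(1) by (simp add: k_def)
    then have "haar_val L i x = 0" if "haar_val L j x \<noteq> 0" for x
      using half[OF that] False True by (auto simp: haar_val_def Let_def)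
    then show ?thesis using assms by simp
  next
    case lt: False
    then have lt: "floor_log i < n" using ni by simp
    have parent: "x div 2 ^ (L - n) = k" if "haar_val L j x \<noteq> 0" for x
    proof -
      have "L - n = Suc (L - Suc n)" using n by simp
      then have "x div 2 ^ (L - n) = x div 2 ^ (L - Suc n) div 2"
        by (simp add: div_mult2_eq[symmetric] mult.commute)
      then show ?thesis using half[OF that] by auto
    qed
    have "L - Suc (floor_log i) = (L - n) + (n - Suc (floor_log i))" using lt n by simp
    then have "x div 2 ^ (L - Suc (floor_log i)) = x div 2 ^ (L - n) div 2 ^ (n - Suc (floor_log i))" for x :: nat
      by (simp add: power_add div_mult2_eq)
    then have "q div 2 ^ (L - Suc (floor_log i)) = q' div 2 ^ (L - Suc (floor_log i))"
      using parent assms(3,4) by metis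
    then show ?thesis by (simp add: haar_val_def)
  qed
qed

lemma sum_of_bool_div_eq:
  fixes a d n :: nat
  assumes "0 < d" "(a + 1) * d \<le> n"
  shows "(\<Sum>q<n. of_bool (q div d = a)) = real d"
proof -
  have "{..<n} \<inter> {q. q div d = a} = {a * d ..< (a + 1) * d}"
  proof (intro equalityI subsetI)
    fix q
    assume "q \<in> {..<n} \<inter> {q. q div d = a}"
    then have "a \<le> q div d" "q div d < a + 1" by auto
    then show "q \<in> {a * d ..< (a + 1) * d}"
      using assms(1) by (simp add: less_eq_div_iff_mult_less_eq div_less_iff_less_mult)
  next
    fix q
    assume q: "q \<in> {a * d ..< (a + 1) * d}"
    then have "a \<le> q div d" "q div d < a + 1"
      using assms(1) by (simp_all add: less_eq_div_iff_mult_less_eq div_less_iff_less_mult)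
    then show "q \<in> {..<n} \<inter> {q. q div d = a}" using q assms(2) by auto
  qed
  then show ?thesis by (simp add: of_bool_def sum.If_cases)
qed

text \<open>Each half of the support consists of \<open>d\<close> cells of level \<open>L\<close>,
  with opposite signs.\<close>

lemma haar_val_sum:
  assumes "0 < i" "i < 2 ^ L"
  shows "(\<Sum>q<2 ^ L. haar_val L i q) = 0"
proof -
  define n where "n = floor_log i"
  define k where "k = i - 2 ^ n"
  define d :: nat where "d = 2 ^ (L - Suc n)"
  have n: "n < L" using floor_log_less[OF assms] by (simp add: n_def)
  have "(2 * k + 2) * d \<le> 2 ^ Suc n * d"
    using haar_index_less[of i] by (intro mult_right_mono) (auto simp: k_def n_def)
  also have "\<dots> = 2 ^ L" using n by (simp add: d_def power_add[symmetric] flip: power_Suc)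
  finally have le: "(2 * k + 2) * d \<le> 2 ^ L" .
  have "(\<Sum>q<2 ^ L. haar_val L i q)
      = (\<Sum>q<2 ^ L. of_bool (q div d = 2 * k)) - (\<Sum>q<2 ^ L. of_bool (q div d = 2 * k + 1))"
    using assms by (simp add: haar_val_def Let_def sum_subtractf d_def n_def k_def)
  also have "(\<Sum>q<2 ^ L. of_bool (q div d = 2 * k)) = real d"
    using le by (intro sum_of_bool_div_eq) (auto simp: d_def)
  also have "(\<Sum>q<2 ^ L. of_bool (q div d = 2 * k + 1)) = real d"
    using le by (intro sum_of_bool_div_eq) (auto simp: d_def)
  finally show ?thesis by simp
qed

lemma haar_val_nonzero:
  assumes "i < 2 ^ L"
  shows "\<exists>q<2 ^ L. haar_val L i q \<noteq> 0"
proof (cases "i = 0")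
  case True
  then show ?thesis by (intro exI[of _ 0]) (simp add: haar_val_def)
next
  case False
  define n where "n = floor_log i"
  define k where "k = i - 2 ^ n"
  define d :: nat where "d = 2 ^ (L - Suc n)"
  have n: "n < L" using floor_log_less[of i L] False assms by (simp add: n_def)
  have "2 * k * d < 2 ^ Suc n * d"
    using haar_index_less[of i] by (intro mult_strict_right_mono) (auto simp: k_def n_def d_def)
  also have "\<dots> = 2 ^ L" using n by (simp add: d_def power_add[symmetric] flip: power_Suc)
  finally have "2 * k * d < 2 ^ L" .
  \<comment> \<open>\<open>2 * k * d\<close> is the first cell of the positive half.\<close>
  moreover have "haar_val L i (2 * k * d) = 1"
    using False by (simp add: haar_val_def Let_def n_def k_def d_def)
  ultimately show ?thesis by (intro exI[of _ "2 * k * d"]) simp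
qed

lemma cell_unique:
  assumes "0 \<le> t" "t < 1"
  shows "\<exists>q<2 ^ L. \<forall>q'. t \<in> cell L q' \<longleftrightarrow> q' = q"
proof (intro exI[of _ "nat \<lfloor>2 ^ L * t\<rfloor>"] conjI allI)
  have "2 ^ L * t < 2 ^ L" "0 \<le> 2 ^ L * t" using assms by auto
  then show "nat \<lfloor>2 ^ L * t\<rfloor> < 2 ^ L" by (simp add: nat_less_iff floor_less_iff)
  fix q'
  have "t \<in> cell L q' \<longleftrightarrow> real q' \<le> 2 ^ L * t \<and> 2 ^ L * t < real q' + 1"
    by (auto simp: field_simps)
  also have "\<dots> \<longleftrightarrow> q' = nat \<lfloor>2 ^ L * t\<rfloor>"
    by (smt (verit) \<open>0 \<le> 2 ^ L * t\<close> floor_eq_iff nat_eq_iff of_int_of_nat_eq zero_le_floor)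
  finally show "t \<in> cell L q' \<longleftrightarrow> q' = nat \<lfloor>2 ^ L * t\<rfloor>" .
qed

text \<open>On \<open>[0, 1)\<close> the integrand is a finite combination of cell indicators; the
  point 1 lies in no cell below 1 and gets its own indicator, whose integral is 0.\<close>

lemma integral_cell_const:
  fixes g :: "real \<Rightarrow> real"
  assumes "\<And>q t. q < 2 ^ L \<Longrightarrow> t \<in> cell L q \<Longrightarrow> g t = g (dpt L q)"
  shows "(LINT t:{0..1}|lborel. g t) = 1 / 2 ^ L * (\<Sum>q<2 ^ L. g (dpt L q))"
proof -
  let ?f = "\<lambda>t. (\<Sum>q<2 ^ L. indicator (cell L q) t *\<^sub>R g (dpt L q)) + indicator {1} t *\<^sub>R g 1"
  have eq: "indicator {0..1} t *\<^sub>R g t = ?f t" for t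
  proof -
    consider "0 \<le> t" "t < 1" | "t = 1" | "t < 0 \<or> 1 < t" by linarith
    then show ?thesis
    proof cases
      case 1
      then obtain q where q: "q < 2 ^ L" "\<And>q'. t \<in> cell L q' \<longleftrightarrow> q' = q" using cell_unique by blast
      have "(\<Sum>q'<2 ^ L. indicator (cell L q') t *\<^sub>R g (dpt L q')) = (\<Sum>q'<2 ^ L. if q = q' then g (dpt L q') else 0)"
        unfolding indicator_def q(2) by (intro sum.cong) auto
      also have "\<dots> = g (dpt L q)" using q(1) by simp
      also have "\<dots> = g t" using assms[OF q(1), of t] q(2)[of q] by metis
      finally show ?thesis using 1 by simp
    next
      case 2
      have "t \<notin> cell L q" if "q < 2 ^ L" for q
        using cell_bounds(2)[OF _ that, of t] 2 by blast
      then show ?thesis using 2 by simp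
    next
      case 3
      have "t \<notin> cell L q" if "q < 2 ^ L" for q
        using cell_bounds[OF _ that, of t] 3 by (meson not_less_iff_gr_or_eq not_less order.asym)
      then have "(\<Sum>q<2 ^ L. indicator (cell L q) t *\<^sub>R g (dpt L q)) = 0"
        by (intro sum.neutral) simp
      then show ?thesis using 3 by auto
    qed
  qed
  have len: "measure lborel (cell L q) = 1 / 2 ^ L" for q
    by (simp add: divide_right_mono diff_divide_distrib[symmetric])
  have int: "integrable lborel (\<lambda>t. indicator (cell L q) t *\<^sub>R g (dpt L q))" for q
  proof (intro integrable_scaleR_left integrable_real_indicator)
    have "dpt L q \<le> dpt L (Suc q)" using dpt_cell[of q L] by simp
    then show "emeasure lborel (cell L q) < \<infinity>" by (simp only: emeasure_lborel_Ico) simp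
  qed simp
  have intS: "integrable lborel (\<lambda>t. \<Sum>q<2 ^ L. indicator (cell L q) t *\<^sub>R g (dpt L q))"
    by (intro Bochner_Integration.integrable_sum int)
  have int1: "integrable lborel (\<lambda>t. indicator {1 :: real} t *\<^sub>R g 1)"
    by (intro integrable_scaleR_left) simp
  have "(LINT t:{0..1}|lborel. g t) = (LINT t|lborel. ?f t)"
    unfolding set_lebesgue_integral_def eq ..
  also have "\<dots> = (LINT t|lborel. (\<Sum>q<2 ^ L. indicator (cell L q) t *\<^sub>R g (dpt L q)))
      + (LINT t|lborel. indicator {1 :: real} t *\<^sub>R g 1)"
    by (rule Bochner_Integration.integral_add[OF intS int1])
  also have "(LINT t|lborel. (\<Sum>q<2 ^ L. indicator (cell L q) t *\<^sub>R g (dpt L q)))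
      = (\<Sum>q<2 ^ L. LINT t|lborel. indicator (cell L q) t *\<^sub>R g (dpt L q))"
    by (intro Bochner_Integration.integral_sum int)
  also have "\<dots> = (\<Sum>q<2 ^ L. 1 / 2 ^ L * g (dpt L q))"
    by (intro sum.cong refl) (simp add: len del: of_nat_Suc)
  also have "(LINT t|lborel. indicator {1 :: real} t *\<^sub>R g 1) = 0"
    by simp
  finally show ?thesis by (simp only: sum_distrib_left add_0_right)
qed

text \<open>The value at the right end point belongs to no cell; it is only produced by \<open>haar 0\<close>.\<close>

definition dyadic_step :: "nat \<Rightarrow> (real \<Rightarrow> real) \<Rightarrow> bool"
  where "dyadic_step L y \<longleftrightarrow> (\<forall>q<2 ^ L. \<forall>t\<in>cell L q. y t = y (dpt L q)) \<and>
    (\<forall>t. t < 0 \<or> 1 < t \<longrightarrow> y t = 0) \<and> y 1 = 1 / 2 ^ L * (\<Sum>q<2 ^ L. y (dpt L q))"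

lemma dyadic_step_haar:
  assumes "i < 2 ^ L"
  shows "dyadic_step L (haar i)"
  unfolding dyadic_step_def
proof (intro conjI allI impI ballI)
  fix q t
  assume "q < 2 ^ L" "t \<in> cell L q"
  then show "haar i t = haar i (dpt L q)"
    using haar_cell[OF assms, of q t] haar_cell[OF assms, of q "dpt L q"] dpt_cell[of q L]
    by metis
next
  have "(\<Sum>q<2 ^ L. haar i (dpt L q)) = (\<Sum>q<2 ^ L. haar_val L i q)"
    using haar_cell[OF assms _ dpt_cell] by (intro sum.cong) auto
  also have "\<dots> = (if i = 0 then 2 ^ L else 0)"
    using haar_val_sum[OF _ assms] by (simp add: haar_val_def)
  finally have s: "(\<Sum>q<2 ^ L. haar i (dpt L q)) = (if i = 0 then 2 ^ L else 0)" .
  show "haar i 1 = 1 / 2 ^ L * (\<Sum>q<2 ^ L. haar i (dpt L q))"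
    unfolding s using haar_outside[of 1 i] by (simp add: haar_def)
qed (auto intro: haar_outside)

lemma dyadic_step_span:
  assumes "y \<in> span S" "\<And>x. x \<in> S \<Longrightarrow> dyadic_step L x"
  shows "dyadic_step L y"
  using assms(1)
proof (induction rule: span_induct_alt)
  case base
  show ?case by (simp add: dyadic_step_def)
next
  case (step c x y)
  have x: "dyadic_step L x" using assms(2) step by blast
  show ?case
    unfolding dyadic_step_def
  proof (intro conjI ballI allI impI)
    fix q t
    assume "q < 2 ^ L" "t \<in> cell L q"
    then have "x t = x (dpt L q)" "y t = y (dpt L q)"
      using x step(2) unfolding dyadic_step_def by blast+
    then show "(c *\<^sub>R x + y) t = (c *\<^sub>R x + y) (dpt L q)" by (simp add: scaleR_fun_def)
  next
    fix t :: real
    assume "t < 0 \<or> 1 < t"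
    then have "x t = 0" "y t = 0" using x step(2) unfolding dyadic_step_def by blast+
    then show "(c *\<^sub>R x + y) t = 0" by (simp add: scaleR_fun_def)
  next
    have "x 1 = 1 / 2 ^ L * (\<Sum>q<2 ^ L. x (dpt L q))" "y 1 = 1 / 2 ^ L * (\<Sum>q<2 ^ L. y (dpt L q))"
      using x step(2) unfolding dyadic_step_def by blast+
    then have "(c *\<^sub>R x + y) 1
        = c * (1 / 2 ^ L * (\<Sum>q<2 ^ L. x (dpt L q))) + 1 / 2 ^ L * (\<Sum>q<2 ^ L. y (dpt L q))"
      by (simp only: scaleR_fun_def plus_fun_apply real_scaleR_def)
    then show "(c *\<^sub>R x + y) 1 = 1 / 2 ^ L * (\<Sum>q<2 ^ L. (c *\<^sub>R x + y) (dpt L q))"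
      by (simp add: scaleR_fun_def sum.distrib distrib_left sum_distrib_left mult_ac)
  qed
qed

text \<open>The condition on \<open>y 1\<close> recovers the end point from the cell values;
  otherwise the indicator of \<open>{1}\<close> would be a counterexample.\<close>

lemma dyadic_step_eq_0:
  assumes "dyadic_step L y" "\<And>q. q < 2 ^ L \<Longrightarrow> y (dpt L q) = 0"
  shows "y = 0"
proof
  fix t :: real
  consider "0 \<le> t" "t < 1" | "t = 1" | "t < 0 \<or> 1 < t" by linarith
  then show "y t = 0 t"
  proof cases
    case 1
    then obtain q where q: "q < 2 ^ L" "t \<in> cell L q" using cell_unique[of t L] by blast
    then have "y t = y (dpt L q)" using assms(1) unfolding dyadic_step_def by blast
    then show ?thesis using assms(2)[OF q(1)] by simp
  next
    case 2
    have "y 1 = 1 / 2 ^ L * (\<Sum>q<2 ^ L. y (dpt L q))"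
      using assms(1) unfolding dyadic_step_def by blast
    then show ?thesis using assms(2) 2 by simp
  next
    case 3
    then have "y t = 0" using assms(1) unfolding dyadic_step_def by blast
    then show ?thesis by simp
  qed
qed

section \<open>The Lp norm of dyadic step functions\<close>

lemma lp_norm_dyadic_step:
  assumes "dyadic_step L y"
  shows "lp_norm p y = (1 / 2 ^ L * (\<Sum>q<2 ^ L. \<bar>y (dpt L q)\<bar> powr p)) powr (1 / p)"
proof -
  have "\<bar>y t\<bar> powr p = \<bar>y (dpt L q)\<bar> powr p" if "q < 2 ^ L" "t \<in> cell L q" for q t
    using assms that unfolding dyadic_step_def by metis
  then have "(LINT t:{0..1}|lborel. \<bar>y t\<bar> powr p) = 1 / 2 ^ L * (\<Sum>q<2 ^ L. \<bar>y (dpt L q)\<bar> powr p)"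
    by (rule integral_cell_const)
  then show ?thesis by (simp add: lp_norm_def)
qed

lemma lp_norm_haar_pos:
  assumes "i < 2 ^ L"
  shows "0 < lp_norm p (haar i)"
proof -
  obtain q where q: "q < 2 ^ L" "haar_val L i q \<noteq> 0" using haar_val_nonzero[OF assms] by blast
  have "0 < (\<Sum>q<2 ^ L. \<bar>haar i (dpt L q)\<bar> powr p)"
    using q haar_cell[OF assms q(1) dpt_cell] by (intro sum_pos2[of _ q]) auto
  then show ?thesis
    using lp_norm_dyadic_step[OF dyadic_step_haar[OF assms], of p] by simp
qed

theorem theorem1p2:
  fixes p :: real
  assumes "1 < p"
  shows "\<forall>m::nat. \<exists>N::nat. 0 < N \<and>
    (\<forall>x \<in> haar_space p m.
       terminates_within (lp_norm p) (xga_select (lp_norm p) (haar_dict p m)) N x \<and>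
       terminates_within (lp_norm p) (dga_select (lp_norm p) (haar_space p m) (haar_dict p m)) N x)"
proof
  fix m :: nat
  \<comment> \<open>Level \<open>m\<close> is fine enough, since \<open>m < 2 ^ m\<close>.\<close>
  define L where "L = m"
  \<comment> \<open>Each cell is represented by its left end point, so sums over \<open>A\<close>
    are sums over cells.\<close>
  define A where "A = dpt L ` {..<2 ^ L}"
  have inj: "inj_on (dpt L) {..<2 ^ L}" by (auto simp: inj_on_def)
  have less: "i < 2 ^ L" if "i \<le> m" for i
    unfolding L_def by (rule le_less_trans[OF that less_exp])
  have e: "haar_normalized p i (dpt L q) = haar_val L i q / lp_norm p (haar i)"
    if "i \<le> m" "q < 2 ^ L" for i q
    using haar_cell[OF less[OF that(1)] that(2) dpt_cell] by (simp add: haar_normalized_def scaleR_fun_def)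
  have pos: "0 < lp_norm p (haar i)" if "i \<le> m" for i
    by (rule lp_norm_haar_pos[OF less[OF that]])
  have step: "dyadic_step L y" if "y \<in> span (haar_normalized p ` {0..m})" for y
  proof (rule dyadic_step_span[OF that])
    fix x
    assume "x \<in> haar_normalized p ` {0..m}"
    then obtain i where i: "i \<le> m" "x = haar_normalized p i" by auto
    then have "x \<in> span {haar i}" by (auto simp: haar_normalized_def intro: span_scale span_base)
    then show "dyadic_step L x"
      by (rule dyadic_step_span) (use dyadic_step_haar less i in auto)
  qed
  have chain: "lp_chain A (1 / 2 ^ L) p (haar_normalized p) m"
  proof
    show "finite A" by (simp add: A_def)
    show "\<exists>t\<in>A. haar_normalized p i t \<noteq> 0" if i: "i \<le> m" for i
    proof -
      obtain q where "q < 2 ^ L" "haar_val L i q \<noteq> 0" using haar_val_nonzero[OF less[OF i]] by blast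
      then show ?thesis using e[OF i] pos[OF i] by (force simp: A_def)
    qed
    show "haar_normalized p i s = haar_normalized p i t"
      if "i < j" "j \<le> m" "s \<in> A" "t \<in> A" "haar_normalized p j s \<noteq> 0" "haar_normalized p j t \<noteq> 0"
      for i j s t
    proof -
      obtain q q' where q: "s = dpt L q" "q < 2 ^ L" "t = dpt L q'" "q' < 2 ^ L"
        using \<open>s \<in> A\<close> \<open>t \<in> A\<close> by (auto simp: A_def)
      then have "haar_val L i q = haar_val L i q'"
        using that e[of j] by (intro haar_val_const[of i j] less) auto
      then show ?thesis using q e[of i] that by simp
    qed
    show "(\<Sum>t\<in>A. haar_normalized p j t) = 0" if j: "0 < j" "j \<le> m" for j
    proof -
      have "(\<Sum>t\<in>A. haar_normalized p j t) = (\<Sum>q<2 ^ L. haar_val L j q / lp_norm p (haar j))"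
        unfolding A_def sum.reindex[OF inj] using e[OF j(2)] by (intro sum.cong) auto
      also have "\<dots> = (\<Sum>q<2 ^ L. haar_val L j q) / lp_norm p (haar j)"
        by (simp add: sum_divide_distrib)
      also have "\<dots> = 0" using haar_val_sum[OF j(1) less[OF j(2)]] by simp
      finally show ?thesis .
    qed
  qed (use assms in auto)
  interpret lp_chain A "1 / 2 ^ L" p "haar_normalized p" m by (rule chain)
  interpret lp_chain_space A "1 / 2 ^ L" p "haar_normalized p" m "lp_norm p"
  proof
    fix y
    assume y: "y \<in> span (haar_normalized p ` {0..m})"
    have "lnorm y = (1 / 2 ^ L * (\<Sum>t\<in>A. \<bar>y t\<bar> powr p)) powr (1 / p)" by (rule lnorm_def)
    also have "(\<Sum>t\<in>A. \<bar>y t\<bar> powr p) = (\<Sum>q<2 ^ L. \<bar>y (dpt L q)\<bar> powr p)"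
      unfolding A_def by (simp add: sum.reindex[OF inj])
    finally show "lp_norm p y = lnorm y" using lp_norm_dyadic_step[OF step[OF y]] by simp
    show "y = 0" if "\<And>t. t \<in> A \<Longrightarrow> y t = 0"
      by (rule dyadic_step_eq_0[OF step[OF y]]) (use that in \<open>auto simp: A_def\<close>)
  qed
  show "\<exists>N::nat. 0 < N \<and>
    (\<forall>x \<in> haar_space p m.
       terminates_within (lp_norm p) (xga_select (lp_norm p) (haar_dict p m)) N x \<and>
       terminates_within (lp_norm p) (dga_select (lp_norm p) (haar_space p m) (haar_dict p m)) N x)"
    using greedy_algorithms_terminate unfolding haar_space_def haar_dict_def .
qed

end
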